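(* Let $A_1,\dots,A_M\in\mathbb{R}^{n\times n}$, $\mathcal{M}=\{1,\dots,M\}$ and $A(w)=\sum_{i\in\mathcal{M}}w_iA_i$ for $w\in\mathcal{W}$. Assume that the difference inclusion $x(k+1)=A(w(k))x(k)$ (resp. the differential inclusion $\dot x(t)=A(w(t))x(t)$) admits a weak quadratic Lyapunov function. Then it is strongly convergent if and only if the dual system $x(k+1)=A^\top(w(k))x(k)$ (resp. $\dot x(t)=A^\top(w(t))x(t)$) is strongly convergent.
   Context: $\mathcal{W}=\{w\in\mathbb{R}^M:\ \sum_{i\in\mathcal{M}}w_i=1,\ w_i\ge0\ \forall i\in\mathcal{M}\}$. The dual system is the one generated by $A_1^\top,\dots,A_M^\top$, with $A^\top(w)=\sum_{i\in\mathcal{M}}w_iA_i^\top$. The inclusion generated by $\{A_i\}_{i\in\mathcal{M}}$ is strongly convergent if for every sequence $w(k)\in\mathcal{W}$, $k\in\mathbb{N}$ (resp. every measurable function $w(t)\in\mathcal{W}$, $t\ge0$) and every $x(0)\in\mathbb{R}^n$ the solution converges, as time tends to infinity, to some $\bar x\in\bar{\mathcal{X}}$, where $\bar{\mathcal{X}}=\bigcap_{i\in\mathcal{M}}\ker(A_i-I)$ in discrete time and $\bar{\mathcal{X}}=\bigcap_{i\in\mathcal{M}}\ker(A_i)$ in continuous time (for the dual system, with $A_i$ replaced by $A_i^\top$). A weak quadratic Lyapunov function is $V(x)=x^\top Px$ with $P$ symmetric positive definite such that, for all $x\in\mathbb{R}^n$ and $w\in\mathcal{W}$, $V(A(w)x)\le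 V(x)$ in discrete time, resp. $x^\top(A(w)^\top P+PA(w))x\le0$ in continuous time. *)

theory Defs
  imports "HOL-Analysis.Analysis"
begin

text \<open>The matrices are \<open>A i\<close> for \<open>i\<close> ranging over a finite (nonempty) index type \<open>'m\<close>.
  The dual system of \<open>A\<close> is the system generated by \<open>\<lambda>i. transpose (A i)\<close>.\<close>

definition weight_simplex :: "(real^'m::finite) set" where
  "weight_simplex = {w. (\<Sum>i\<in>UNIV. w $ i) = 1 \<and> (\<forall>i. 0 \<le> w $ i)}"

definition weighted_matrix :: "('m::finite \<Rightarrow> real^'n^'n) \<Rightarrow> real^'m \<Rightarrow> real^'n^'n" where
  "weighted_matrix A w = (\<Sum>i\<in>UNIV. w $ i *\<^sub>R A i)"


subsection \<open>Discrete time\<close>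

definition equilibria_dt :: "('m::finite \<Rightarrow> real^'n^'n) \<Rightarrow> (real^'n) set" where
  "equilibria_dt A = (\<Inter>i. {x. (A i - mat 1) *v x = 0})"

definition solution_dt ::
    "('m::finite \<Rightarrow> real^'n^'n) \<Rightarrow> (nat \<Rightarrow> real^'m) \<Rightarrow> (nat \<Rightarrow> real^'n) \<Rightarrow> bool" where
  "solution_dt A w x \<longleftrightarrow> (\<forall>k. x (Suc k) = weighted_matrix A (w k) *v x k)"

definition strongly_convergent_dt :: "('m::finite \<Rightarrow> real^'n^'n) \<Rightarrow> bool" where
  "strongly_convergent_dt A \<longleftrightarrow>
    (\<forall>w x. (\<forall>k. w k \<in> weight_simplex) \<and> solution_dt A w x \<longrightarrow>
      (\<exists>xbar\<in>equilibria_dt A. x \<longlonglongrightarrow> xbar))"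


subsection \<open>Continuous time\<close>

definition equilibria_ct :: "('m::finite \<Rightarrow> real^'n^'n) \<Rightarrow> (real^'n) set" where
  "equilibria_ct A = (\<Inter>i. {x. A i *v x = 0})"

text \<open>Absolute continuity of a function (the constant \<^const>\<open>absolutely_continuous\<close> of
  the library is about measures). The members of a division are compact intervals with disjoint
  interiors; the interval \<open>k\<close> is \<open>{Inf k..Sup k}\<close>.\<close>

definition absolutely_continuous_on :: "real set \<Rightarrow> (real \<Rightarrow> 'a::real_normed_vector) \<Rightarrow> bool" where
  "absolutely_continuous_on S f \<longleftrightarrow>
    (\<forall>\<epsilon>>0. \<exists>\<delta>>0. \<forall>D T. D division_of T \<and> T \<subseteq> S \<and> (\<Sum>k\<in>D. Sup k - Inf k) < \<delta> \<longrightarrow>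
      (\<Sum>k\<in>D. norm (f (Sup k) - f (Inf k))) < \<epsilon>)"

text \<open>Solutions are meant in the sense of Caratheodory: locally absolutely continuous on
  \<open>[0, \<infinity>)\<close>, satisfying the differential equation for almost every \<open>t \<ge> 0\<close>.\<close>

definition solution_ct ::
    "('m::finite \<Rightarrow> real^'n^'n) \<Rightarrow> (real \<Rightarrow> real^'m) \<Rightarrow> (real \<Rightarrow> real^'n) \<Rightarrow> bool" where
  "solution_ct A w x \<longleftrightarrow>
    (\<forall>b\<ge>0. absolutely_continuous_on {0..b} x) \<and>
    (AE t in lebesgue_on {0..}.
      (x has_vector_derivative (weighted_matrix A (w t) *v x t)) (at t within {0..}))"

definition strongly_convergent_ct :: "('m::finite \<Rightarrow> real^'n^'n) \<Rightarrow> bool" where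
  "strongly_convergent_ct A \<longleftrightarrow>
    (\<forall>w x. w \<in> borel_measurable (lebesgue_on {0..}) \<and> (\<forall>t\<ge>0. w t \<in> weight_simplex) \<and>
        solution_ct A w x \<longrightarrow>
      (\<exists>xbar\<in>equilibria_ct A. (x \<longlongrightarrow> xbar) at_top))"


subsection \<open>Weak quadratic Lyapunov functions\<close>

definition positive_definite :: "real^'n^'n \<Rightarrow> bool" where
  "positive_definite P \<longleftrightarrow> transpose P = P \<and> (\<forall>x. x \<noteq> 0 \<longrightarrow> 0 < x \<bullet> (P *v x))"

definition weak_quadratic_lyapunov_dt :: "('m::finite \<Rightarrow> real^'n^'n) \<Rightarrow> real^'n^'n \<Rightarrow> bool" where
  "weak_quadratic_lyapunov_dt A P \<longleftrightarrow> positive_definite P \<and>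
    (\<forall>x. \<forall>w\<in>weight_simplex.
      (weighted_matrix A w *v x) \<bullet> (P *v (weighted_matrix A w *v x)) \<le> x \<bullet> (P *v x))"

definition weak_quadratic_lyapunov_ct :: "('m::finite \<Rightarrow> real^'n^'n) \<Rightarrow> real^'n^'n \<Rightarrow> bool" where
  "weak_quadratic_lyapunov_ct A P \<longleftrightarrow> positive_definite P \<and>
    (\<forall>x. \<forall>w\<in>weight_simplex.
      x \<bullet> ((transpose (weighted_matrix A w) ** P + P ** weighted_matrix A w) *v x) \<le> 0)"

end

theory Submission
  imports Defs
begin

text \<open>
  Measure vectors by the energy norm \<open>sqrt (x \<bullet> P x)\<close> of the Lyapunov function \<open>P\<close>. The
  transition matrices of the system over one time unit (the matrices \<open>A(w)\<close> in discrete time, the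
  time-one maps of all measurable controls in continuous time) are contractions for this norm.
  Let \<open>E\<close> be the space of common equilibria. A contraction fixing \<open>e\<close> has a transpose fixing
  \<open>P e\<close>, so the \<open>P\<close>-orthogonal complement of \<open>E\<close> is invariant, and strong convergence says that
  every trajectory in this complement tends to zero.

  The point is that this decay is automatically uniform: there is a horizon after which
  \<^emph>\<open>all\<close> products of transition matrices have norm at most \<open>\<epsilon>\<close> on the complement
  (\<open>uniform_decay\<close>). Otherwise compactness of the unit sphere yields a vector from which a fixed
  amount of energy can be kept for arbitrarily long times, by a choice of matrices depending on the
  time; giving away a little energy at each step, these choices can be merged into one trajectory
  that does not decay. The loss of energy absorbs the error made in replacing a limit point of the
  reachable points by a nearby point that is actually reached.

  Transposing a product reverses the order of its factors, and the reversed product is again a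
  product of transition matrices, so the uniform bound passes to the dual system. This gives
  \<open>transpose_convergent\<close>: each trajectory of the transposes tends to \<open>P e\<close> for some \<open>e \<in> E\<close>. In
  discrete time this is the theorem. In continuous time, the transpose of the time-one map of a
  control is the time-one map of the dual system under the time-reversed control
  (\<open>solves_adjoint\<close>: \<open>x(1 - t) \<bullet> y(t)\<close> is constant). This needs solutions for arbitrary measurable
  controls (\<open>caratheodory_existence\<close>), and a fundamental theorem of calculus for absolutely
  continuous functions to draw conclusions from derivatives that exist almost everywhere.
  Between integer times the dual trajectory is controlled by the energy norm of \<open>P\<close>
  inverse, which is a weak Lyapunov function of the dual system. Since the transpose is an
  involution, the converse implications follow by exchanging the two systems.
\<close>

section \<open>Positive definite forms and the energy norm\<close>

text \<open>Transposes have to stay matrices here, as they are the matrices of the dual system; the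
  default rewriting to products of row vectors is therefore switched off.\<close>

declare transpose_matrix_vector [simp del]

lemma inner_matrix_vector_transpose:
  fixes A :: "real^'n^'m"
  shows "(A *v x) \<bullet> y = x \<bullet> (transpose A *v y)"
  by (metis dot_lmul_matrix inner_commute transpose_matrix_vector)

lemma matrix_vector_mult_sum_left:
  fixes A :: "'i \<Rightarrow> real^'n^'m"
  shows "(\<Sum>i\<in>I. A i) *v x = (\<Sum>i\<in>I. A i *v x)"
  by (induction I rule: infinite_finite_induct) (simp_all add: matrix_vector_mult_add_rdistrib)

text \<open>A zero of a nonnegative form is a minimum, so its gradient vanishes there. Applied to
  \<open>P - T\<^sup>T P T\<close> and to \<open>- (T\<^sup>T P + P T)\<close>, this turns equilibria of a system into equilibria of its dual.\<close>

lemma kernel_of_nonneg_form: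
  fixes B :: "real^'n^'n"
  assumes sym: "transpose B = B" and nn: "\<And>x. 0 \<le> x \<bullet> (B *v x)" and x: "x \<bullet> (B *v x) = 0"
  shows "B *v x = 0"
proof (rule ccontr)
  assume "B *v x \<noteq> 0"
  define y where "y = B *v x"
  define a where "a = y \<bullet> y"
  define b where "b = y \<bullet> (B *v y)"
  have a: "a > 0" using \<open>B *v x \<noteq> 0\<close> by (simp add: a_def y_def)
  have b: "b \<ge> 0" using nn by (simp add: b_def)
  have xy: "x \<bullet> (B *v y) = a"
    using inner_matrix_vector_transpose[of B x y] sym by (simp add: a_def y_def)
  have q: "(x - t *\<^sub>R y) \<bullet> (B *v (x - t *\<^sub>R y)) = t * (t * b - 2 * a)" for t
    using x by (simp add: matrix_vector_mult_diff_distrib matrix_vector_mult_scaleR inner_diff_left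
        inner_diff_right xy y_def[symmetric] a_def[symmetric] b_def[symmetric] algebra_simps)
  \<comment> \<open>Moving against the gradient: the quadratic \<open>t * (t * b - 2 * a)\<close> is negative for small
    \<open>t > 0\<close>, and \<open>b + 1\<close> in place of \<open>b\<close> covers the case \<open>b = 0\<close>.\<close>
  define t where "t = a / (b + 1)"
  have "t > 0" using a b by (simp add: t_def)
  moreover have "t * b \<le> a" using a b by (simp add: t_def field_simps)
  ultimately have "t * (t * b - 2 * a) < 0" using a by (intro mult_pos_neg) auto
  then show False using nn[of "x - t *\<^sub>R y"] q[of t] by simp
qed

definition energy_norm :: "real^'n^'n \<Rightarrow> real^'n \<Rightarrow> real" where
  "energy_norm P x = sqrt (x \<bullet> (P *v x))"

context
  fixes P :: "real^'n^'n"
  assumes pd: "positive_definite P"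
begin

lemma positive_definite_sym: "x \<bullet> (P *v y) = y \<bullet> (P *v x)"
  using inner_matrix_vector_transpose[of P y x] pd
  by (simp add: positive_definite_def inner_commute)

lemma positive_definite_nonneg: "0 \<le> x \<bullet> (P *v x)"
  using pd by (cases "x = 0") (auto simp: positive_definite_def less_imp_le)

lemma energy_norm_sq: "(energy_norm P x)\<^sup>2 = x \<bullet> (P *v x)"
  by (simp add: energy_norm_def positive_definite_nonneg)

lemma energy_norm_nonneg: "0 \<le> energy_norm P x"
  by (simp add: energy_norm_def positive_definite_nonneg)

lemma energy_norm_eq_0: "energy_norm P x = 0 \<longleftrightarrow> x = 0"
  using pd by (force simp: energy_norm_def positive_definite_def)

lemma energy_norm_scaleR: "energy_norm P (c *\<^sub>R x) = \<bar>c\<bar> * energy_norm P x"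
proof -
  have "(c *\<^sub>R x) \<bullet> (P *v (c *\<^sub>R x)) = c\<^sup>2 * (x \<bullet> (P *v x))"
    by (simp add: matrix_vector_mult_scaleR power2_eq_square)
  then show ?thesis by (simp add: energy_norm_def real_sqrt_mult)
qed

lemma energy_norm_Cauchy_Schwarz: "x \<bullet> (P *v y) \<le> energy_norm P x * energy_norm P y"
proof (cases "y = 0")
  case True
  then show ?thesis by (simp add: energy_norm_def)
next
  case False
  define a where "a = x \<bullet> (P *v x)"
  define b where "b = y \<bullet> (P *v y)"
  define c where "c = x \<bullet> (P *v y)"
  have b: "b > 0" using False pd by (simp add: b_def positive_definite_def)
  have yx: "y \<bullet> (P *v x) = c" by (simp add: c_def positive_definite_sym[of y])
  have "0 \<le> (b *\<^sub>R x - c *\<^sub>R y) \<bullet> (P *v (b *\<^sub>R x - c *\<^sub>R y))"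
    by (rule positive_definite_nonneg)
  also have "\<dots> = b * (a * b - c\<^sup>2)"
    by (simp add: matrix_vector_mult_diff_distrib matrix_vector_mult_scaleR inner_diff_left
        inner_diff_right yx a_def[symmetric] b_def[symmetric] c_def[symmetric]
        algebra_simps power2_eq_square)
  finally have "c\<^sup>2 \<le> a * b" using b by (simp add: zero_le_mult_iff)
  then have "\<bar>c\<bar> \<le> sqrt (a * b)" by (metis real_sqrt_abs real_sqrt_le_mono)
  then show ?thesis
    by (simp add: energy_norm_def real_sqrt_mult a_def b_def c_def)
qed

lemma energy_norm_triangle: "energy_norm P (x + y) \<le> energy_norm P x + energy_norm P y"
proof -
  have "(energy_norm P (x + y))\<^sup>2 = (energy_norm P x)\<^sup>2 + (energy_norm P y)\<^sup>2 + 2 * (x \<bullet> (P *v y))"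
    unfolding energy_norm_sq
    by (simp add: matrix_vector_right_distrib inner_add_left inner_add_right positive_definite_sym[of y x])
  also have "\<dots> \<le> (energy_norm P x + energy_norm P y)\<^sup>2"
    using energy_norm_Cauchy_Schwarz[of x y] by (simp add: power2_sum)
  finally show ?thesis
    using energy_norm_nonneg by (metis add_nonneg_nonneg power2_le_imp_le)
qed

lemma energy_norm_coercive: "\<exists>c>0. \<forall>x. c * norm x \<le> energy_norm P x"
proof -
  have cont: "continuous_on (sphere 0 1) (energy_norm P)"
    unfolding energy_norm_def by (intro continuous_intros)
  obtain m :: "real^'n" where m: "m \<in> sphere 0 1" "\<And>y. y \<in> sphere 0 1 \<Longrightarrow> energy_norm P m \<le> energy_norm P y"
    using continuous_attains_inf[OF compact_sphere _ cont] by auto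
  have "m \<noteq> 0" using m(1) by auto
  then have pos: "energy_norm P m > 0"
    using energy_norm_nonneg[of m] energy_norm_eq_0[of m] by linarith
  have "energy_norm P m * norm x \<le> energy_norm P x" for x
  proof (cases "x = 0")
    case True then show ?thesis by (simp add: energy_norm_nonneg)
  next
    case False
    have "energy_norm P m \<le> energy_norm P ((1 / norm x) *\<^sub>R x)"
      using False by (intro m(2)) simp
    then show ?thesis using False by (simp add: energy_norm_scaleR field_simps)
  qed
  with pos show ?thesis by blast
qed

lemma tendsto_energy_norm: "(f \<longlongrightarrow> l) F \<Longrightarrow> ((\<lambda>t. energy_norm P (f t)) \<longlongrightarrow> energy_norm P l) F"
  unfolding energy_norm_def by (intro tendsto_intros bounded_linear.tendsto[OF matrix_vector_mul_bounded_linear])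

lemma tendsto_0_if_energy_norm:
  assumes "((\<lambda>t. energy_norm P (f t)) \<longlongrightarrow> 0) F"
  shows "(f \<longlongrightarrow> 0) F"
proof -
  obtain c where c: "c > 0" "\<And>x. c * norm x \<le> energy_norm P x"
    using energy_norm_coercive by blast
  have "((\<lambda>t. inverse c * energy_norm P (f t)) \<longlongrightarrow> 0) F"
    using tendsto_mult_left[OF assms, of "inverse c"] by simp
  moreover have "norm (f t) \<le> inverse c * energy_norm P (f t)" for t
    using c by (simp add: field_simps)
  ultimately show ?thesis by (intro Lim_null_comparison[of f]) auto
qed

lemma bounded_if_energy_norm_bounded:
  assumes "\<And>x. x \<in> S \<Longrightarrow> energy_norm P x \<le> C"
  shows "bounded S"
proof -
  obtain c where c: "c > 0" "\<And>x. c * norm x \<le> energy_norm P x"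
    using energy_norm_coercive by blast
  have "norm x \<le> C / c" if "x \<in> S" for x
    using c assms[OF that] by (simp add: field_simps) (meson order_trans)
  then show ?thesis by (auto simp: bounded_iff)
qed

lemma positive_definite_inverse:
  obtains R where "positive_definite R" "\<And>x. R *v (P *v x) = x" "\<And>x. P *v (R *v x) = x"
proof -
  have "\<exists>R. R ** P = mat 1"
    unfolding matrix_left_invertible_ker using pd by (force simp: positive_definite_def)
  then obtain R where R: "R ** P = mat 1" by blast
  then have PR: "P ** R = mat 1" using matrix_left_right_inverse by blast
  have 1: "R *v (P *v x) = x" "P *v (R *v x) = x" for x
    by (simp_all add: matrix_vector_mul_assoc R PR)
  have "transpose R ** P = mat 1"
    using PR pd by (metis matrix_transpose_mul positive_definite_def transpose_mat)
  then have "transpose R = R"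
    by (metis PR matrix_mul_assoc matrix_mul_lid matrix_mul_rid)
  moreover have "0 < x \<bullet> (R *v x)" if "x \<noteq> 0" for x
  proof -
    have "R *v x \<noteq> 0" using 1(2)[of x] that by force
    then have "0 < (R *v x) \<bullet> (P *v (R *v x))" using pd by (simp add: positive_definite_def)
    then show ?thesis by (simp add: 1 inner_commute)
  qed
  ultimately have "positive_definite R" by (simp add: positive_definite_def)
  with 1 that show ?thesis by blast
qed

text \<open>The two subspaces meet only in zero by definiteness, and the complement is the Euclidean
  complement of the image of \<open>E\<close> under \<open>P\<close>, so that the dimensions add up.\<close>

lemma positive_definite_decomposition:
  assumes E: "subspace E"
  obtains e z where "e \<in> E" "\<And>d. d \<in> E \<Longrightarrow> z \<bullet> (P *v d) = 0" "x = e + z"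
proof -
  define S where "S = {z. \<forall>u \<in> (*v) P ` E. orthogonal u z}"
  have S: "z \<in> S \<longleftrightarrow> (\<forall>d\<in>E. z \<bullet> (P *v d) = 0)" for z
    by (auto simp: S_def orthogonal_def inner_commute)
  have "inj ((*v) P)"
  proof -
    obtain R where "\<And>x. R *v (P *v x) = x" using positive_definite_inverse by metis
    then show ?thesis by (metis injI)
  qed
  then have dimPE: "dim ((*v) P ` E) = dim E"
    by (intro dim_image_eq matrix_vector_mul_linear) (auto intro: inj_on_subset)
  have subS: "subspace S"
    by (auto simp: subspace_def S inner_add_left)
  have subPE: "subspace ((*v) P ` E)"
    using linear_subspace_image[of "(*v) P" E] E by auto
  have dimS: "dim S + dim E = dim (UNIV :: (real^'n) set)"
    using dim_subspace_orthogonal_to_vectors[OF subPE subspace_UNIV] dimPE by (simp add: S_def)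
  have "E \<inter> S = {0}"
  proof -
    have "z = 0" if "z \<in> E" "z \<in> S" for z
      using that pd unfolding S positive_definite_def by (metis less_irrefl)
    then show ?thesis using E subS by (auto simp: subspace_0)
  qed
  then have "dim {a + b |a b. a \<in> E \<and> b \<in> S} = dim (UNIV :: (real^'n) set)"
    using dim_sums_Int[OF E subS] dimS by simp
  moreover have "subspace {a + b |a b. a \<in> E \<and> b \<in> S}"
    using subspace_sums[OF E subS] by simp
  ultimately have "{a + b |a b. a \<in> E \<and> b \<in> S} = UNIV"
    by (intro subspace_dim_equal subspace_UNIV) auto
  then show ?thesis using that S by blast
qed

end

section \<open>Transposing a family of contractions\<close>

primrec trajectory :: "(nat \<Rightarrow> real^'n^'n) \<Rightarrow> real^'n \<Rightarrow> nat \<Rightarrow> real^'n" where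
  "trajectory T x 0 = x"
| "trajectory T x (Suc k) = T k *v trajectory T x k"

lemma trajectory_unique:
  assumes "\<And>k. x (Suc k) = T k *v x k"
  shows "trajectory T (x 0) k = x k"
  by (induction k) (simp_all add: assms)

lemma trajectory_Suc_shift: "trajectory T x (Suc n) = trajectory (\<lambda>i. T (Suc i)) (T 0 *v x) n"
  by (induction n) simp_all

lemma trajectory_diff: "trajectory T (x - y) n = trajectory T x n - trajectory T y n"
  by (induction n) (simp_all add: matrix_vector_mult_diff_distrib)

lemma trajectory_scaleR: "trajectory T (c *\<^sub>R x) n = c *\<^sub>R trajectory T x n"
  by (induction n) (simp_all add: matrix_vector_mult_scaleR)

text \<open>Transposition reverses the order of the factors: running the transposed system for \<open>n\<close> steps
  is dual to running the original one with the first \<open>n\<close> matrices in reverse order.\<close>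

lemma trajectory_transpose:
  assumes y: "\<And>k. y (Suc k) = transpose (T k) *v y k"
  shows "x \<bullet> y n = trajectory (\<lambda>i. T (n - Suc i)) x n \<bullet> y 0"
proof -
  have "j \<le> n \<Longrightarrow> x \<bullet> y n = trajectory (\<lambda>i. T (n - Suc i)) x j \<bullet> y (n - j)" for j
  proof (induction j)
    case (Suc j)
    then have "y (n - j) = transpose (T (n - Suc j)) *v y (n - Suc j)"
      using y[of "n - Suc j"] by (simp add: Suc_diff_Suc)
    with Suc show ?case by (simp add: inner_matrix_vector_transpose)
  qed simp
  from this[of n] show ?thesis by simp
qed

text \<open>The common abstraction of both kinds of time: \<open>TT\<close> is the set of transition matrices over one
  time unit and \<open>E\<close> consists of equilibria.\<close>

locale convergent_contractions =
  fixes P :: "real^'n^'n" and TT :: "(real^'n^'n) set" and E :: "(real^'n) set"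
  assumes pd: "positive_definite P"
    and contraction: "\<And>T x. T \<in> TT \<Longrightarrow> (T *v x) \<bullet> (P *v (T *v x)) \<le> x \<bullet> (P *v x)"
    and subspace_E: "subspace E"
    and fixed: "\<And>T e. T \<in> TT \<Longrightarrow> e \<in> E \<Longrightarrow> T *v e = e"
    and convergent: "\<And>T x. range T \<subseteq> TT \<Longrightarrow> \<exists>xbar\<in>E. trajectory T x \<longlonglongrightarrow> xbar"
begin

abbreviation p where "p \<equiv> energy_norm P"

lemma p_contraction: "T \<in> TT \<Longrightarrow> p (T *v x) \<le> p x"
  by (simp add: energy_norm_def contraction)

lemma p_trajectory_mono:
  assumes "range T \<subseteq> TT" "m \<le> n"
  shows "p (trajectory T x n) \<le> p (trajectory T x m)"
  using assms(2)
proof (induction n rule: dec_induct)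
  case (step n)
  have "T n \<in> TT" using assms(1) by auto
  from p_contraction[OF this] step show ?case by (auto intro: order_trans)
qed simp

text \<open>From \<open>x\<close>, the energy norm \<open>c\<close> can be kept up to any given time; the choice of the matrices may
  depend on that time.\<close>

definition persistent :: "real \<Rightarrow> real^'n \<Rightarrow> bool" where
  "persistent c x \<longleftrightarrow> (\<forall>N. \<exists>T. range T \<subseteq> TT \<and> c \<le> p (trajectory T x N))"

lemma p_trajectory_perturb:
  assumes "range T \<subseteq> TT"
  shows "p (trajectory T x n) \<le> p (trajectory T y n) + p (x - y)"
proof -
  have "p (trajectory T x n) \<le> p (trajectory T y n) + p (trajectory T (x - y) n)"
    using energy_norm_triangle[OF pd, of "trajectory T y n" "trajectory T (x - y) n"]
    by (simp add: trajectory_diff)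
  then show ?thesis using p_trajectory_mono[OF assms, of 0 n "x - y"] by simp
qed

lemma persistent_perturb:
  assumes "persistent c x" "p (x - z) \<le> c - c'"
  shows "persistent c' z"
  unfolding persistent_def
proof
  fix N
  obtain T where T: "range T \<subseteq> TT" "c \<le> p (trajectory T x N)"
    using assms(1) unfolding persistent_def by blast
  have "c' \<le> p (trajectory T z N)"
    using p_trajectory_perturb[OF T(1), of x N z] T(2) assms(2) by linarith
  then show "\<exists>T. range T \<subseteq> TT \<and> c' \<le> p (trajectory T z N)" using T(1) by blast
qed

lemma eventually_close:
  assumes "f \<longlonglongrightarrow> l" "\<epsilon> > 0"
  shows "eventually (\<lambda>n. p (f n - l) < \<epsilon>) sequentially"
proof -
  have "(\<lambda>n. p (f n - l)) \<longlonglongrightarrow> 0"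
    using tendsto_energy_norm[OF pd LIM_zero[OF assms(1)]] by (simp add: energy_norm_def)
  then show ?thesis using assms(2) order_tendstoD(2) by blast
qed

text \<open>The limit only has to keep energy up to a fixed time \<open>N\<close>. A late member of the subsequence is
  close to the limit and keeps the energy \<open>c\<close> for longer than \<open>N\<close>, and contractions do not
  amplify the distance.\<close>

lemma persistent_limit:
  assumes T: "\<And>N. range (T N) \<subseteq> TT" and c: "\<And>N. c \<le> p (trajectory (T N) (x N) N)"
    and r: "strict_mono r" and l: "(x \<circ> r) \<longlonglongrightarrow> l" and "c' < c"
  shows "persistent c' l"
  unfolding persistent_def
proof
  fix N
  have "eventually (\<lambda>j. p ((x \<circ> r) j - l) < c - c' \<and> N \<le> j) sequentially"
    using eventually_close[OF l, of "c - c'"] \<open>c' < c\<close> eventually_ge_at_top[of N]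
    by (auto intro: eventually_conj)
  then obtain j where j: "p (x (r j) - l) < c - c'" "N \<le> j"
    using eventually_happens by fastforce
  have "N \<le> r j" using j(2) seq_suble[OF r, of j] by linarith
  have "c \<le> p (trajectory (T (r j)) l (r j)) + p (x (r j) - l)"
    using c p_trajectory_perturb[OF T] order_trans by blast
  then have "c' \<le> p (trajectory (T (r j)) l (r j))" using j by linarith
  also have "\<dots> \<le> p (trajectory (T (r j)) l N)" by (rule p_trajectory_mono[OF T \<open>N \<le> r j\<close>])
  finally show "\<exists>T. range T \<subseteq> TT \<and> c' \<le> p (trajectory T l N)" using T by blast
qed

lemma bounded_sequence_limit:
  assumes "\<And>N. p (x N) \<le> C"
  obtains l r where "strict_mono (r :: nat \<Rightarrow> nat)" "(x \<circ> r) \<longlonglongrightarrow> l"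
proof -
  have "bounded (range x)"
    by (rule bounded_if_energy_norm_bounded[OF pd, where C = C]) (use assms in auto)
  then show ?thesis using bounded_imp_convergent_subsequence that by metis
qed

text \<open>For each horizon there is a good first matrix, but it may change with the horizon. The
  points reached by these first steps accumulate at some persistent \<open>l\<close>, which need not be
  reachable itself; a reached point close to \<open>l\<close> is still persistent at the smaller level \<open>c'\<close>.\<close>

lemma persistent_step:
  assumes "persistent c x" "c' < c"
  shows "\<exists>T\<in>TT. persistent c' (T *v x)"
proof -
  have "\<forall>N. \<exists>T. range T \<subseteq> TT \<and> c \<le> p (trajectory T x (Suc N))"
    using assms(1) unfolding persistent_def by blast
  from choice[OF this] obtain T
    where T: "\<And>N. range (T N) \<subseteq> TT" "\<And>N. c \<le> p (trajectory (T N) x (Suc N))"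
    by blast
  define y where "y N = T N 0 *v x" for N
  have T0: "T N 0 \<in> TT" for N using T(1)[of N] by auto
  have tail: "range (\<lambda>i. T N (Suc i)) \<subseteq> TT" for N using T(1)[of N] by auto
  have "p (y N) \<le> p x" for N unfolding y_def by (rule p_contraction[OF T0])
  then obtain l r where r: "strict_mono r" "(y \<circ> r) \<longlonglongrightarrow> l"
    by (rule bounded_sequence_limit)
  have "c \<le> p (trajectory (\<lambda>i. T N (Suc i)) (y N) N)" for N
    using T(2)[of N] unfolding y_def trajectory_Suc_shift .
  from persistent_limit[OF tail this r, of "(c + c') / 2"]
  have l: "persistent ((c + c') / 2) l" using \<open>c' < c\<close> by simp
  obtain j where "p ((y \<circ> r) j - l) < (c - c') / 2"
    using eventually_close[OF r(2), of "(c - c') / 2"] \<open>c' < c\<close>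
    by (auto dest: eventually_happens)
  then have "p (l - y (r j)) \<le> (c + c') / 2 - c'"
    using energy_norm_scaleR[OF pd, of "-1" "l - y (r j)"] by (simp add: field_simps)
  from persistent_perturb[OF l this] show ?thesis
    unfolding y_def using T0 by blast
qed

lemma persistent_trajectory:
  assumes "persistent c x" "c > 0"
  obtains T where "range T \<subseteq> TT" "\<And>k. c / 2 \<le> p (trajectory T x k)"
proof -
  \<comment> \<open>Energy levels that strictly decrease, as every step costs some energy, but stay above \<open>c / 2\<close>.\<close>
  define d where "d k = c / 2 + (c / 2) * (1 / 2) ^ k" for k :: nat
  have dec: "d (Suc k) < d k" for k using \<open>c > 0\<close> by (simp add: d_def)
  have "\<exists>f. \<forall>k. (persistent (d k) (f k) \<and> (k = 0 \<longrightarrow> f k = x)) \<and> (\<exists>T\<in>TT. f (Suc k) = T *v f k)"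
  proof (rule dependent_nat_choice)
    show "\<exists>y. persistent (d 0) y \<and> (0 = (0::nat) \<longrightarrow> y = x)"
      using assms by (auto simp: d_def)
    show "\<exists>z. (persistent (d (Suc k)) z \<and> (Suc k = 0 \<longrightarrow> z = x)) \<and> (\<exists>T\<in>TT. z = T *v y)"
      if "persistent (d k) y \<and> (k = 0 \<longrightarrow> y = x)" for y k
      using persistent_step[OF _ dec, of k y] that by auto
  qed
  then obtain f where f: "\<And>k. persistent (d k) (f k)" "f 0 = x" "\<And>k. \<exists>T\<in>TT. f (Suc k) = T *v f k"
    by blast
  from f(3) obtain T where T: "\<And>k. T k \<in> TT" "\<And>k. f (Suc k) = T k *v f k" by metis
  have "trajectory T x k = f k" for k using trajectory_unique[of f T k] T(2) f(2) by simp
  moreover have "c / 2 \<le> p (f k)" for k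
  proof -
    have "c / 2 \<le> d k" using \<open>c > 0\<close> by (simp add: d_def)
    moreover have "\<exists>S. d k \<le> p (trajectory S (f k) 0)" using f(1)[of k] unfolding persistent_def by blast
    ultimately show ?thesis by auto
  qed
  ultimately show ?thesis using that[of T] T(1) by auto
qed

text \<open>A fixed point \<open>e\<close> of a contraction is a zero of the nonnegative form
  \<open>x \<bullet> P x - T x \<bullet> P (T x)\<close>.\<close>

lemma transpose_fixed:
  assumes "T \<in> TT" "e \<in> E"
  shows "transpose T *v (P *v e) = P *v e"
proof -
  define B where "B = P - transpose T ** P ** T"
  have Bx: "B *v x = P *v x - transpose T *v (P *v (T *v x))" for x
    by (simp add: B_def matrix_vector_mult_diff_rdistrib matrix_vector_mul_assoc matrix_mul_assoc)
  have Bq: "x \<bullet> (B *v x) = x \<bullet> (P *v x) - (T *v x) \<bullet> (P *v (T *v x))" for x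
    by (simp add: Bx inner_diff_right inner_matrix_vector_transpose)
  have "transpose B = B"
  proof -
    have "transpose (P - C) = transpose P - transpose C" for C by (simp add: transpose_def vec_eq_iff)
    then show ?thesis using pd by (simp add: B_def positive_definite_def matrix_transpose_mul matrix_mul_assoc)
  qed
  then have "B *v e = 0"
    by (rule kernel_of_nonneg_form) (use contraction[OF assms(1)] fixed[OF assms] in \<open>simp_all add: Bq\<close>)
  then show ?thesis using Bx[of e] fixed[OF assms] by simp
qed

definition stable_complement :: "(real^'n) set" where
  "stable_complement = {x. \<forall>e\<in>E. x \<bullet> (P *v e) = 0}"

lemma stable_complement_invariant:
  assumes "x \<in> stable_complement" "range T \<subseteq> TT"
  shows "trajectory T x k \<in> stable_complement"
proof (induction k)
  case (Suc k)
  have "T k \<in> TT" using assms(2) by auto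
  with Suc show ?case by (simp add: stable_complement_def inner_matrix_vector_transpose transpose_fixed)
qed (simp add: assms)

lemma closed_stable_complement: "closed stable_complement"
proof -
  have "stable_complement = (\<Inter>e\<in>E. {x. x \<bullet> (P *v e) = 0})" by (auto simp: stable_complement_def)
  moreover have "closed {x. x \<bullet> (P *v e) = 0}" for e
    by (intro closed_Collect_eq continuous_intros)
  ultimately show ?thesis by auto
qed

text \<open>Without uniformity there are unit vectors keeping the energy \<open>\<epsilon>\<close> for longer and longer times; a
  limit point of them is persistent, so some trajectory keeps energy \<open>\<epsilon> / 4\<close> for ever. But
  that trajectory converges to a point of \<open>E\<close> that is orthogonal to \<open>E\<close>, hence to zero.\<close>

lemma uniform_decay:
  assumes "\<epsilon> > 0"
  shows "\<exists>N. \<forall>n\<ge>N. \<forall>x\<in>stable_complement. \<forall>T. range T \<subseteq> TT \<longrightarrow> p (trajectory T x n) \<le> \<epsilon> * p x"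
proof (rule ccontr)
  assume "\<not> ?thesis"
  then have bad: "\<forall>N. \<exists>n x T. N \<le> n \<and> x \<in> stable_complement \<and> range T \<subseteq> TT \<and> \<epsilon> * p x < p (trajectory T x n)"
    by (metis linorder_not_le)
  have "\<exists>u T. u \<in> stable_complement \<and> p u = 1 \<and> range T \<subseteq> TT \<and> \<epsilon> \<le> p (trajectory T u N)" for N
  proof -
    obtain n x T where *: "N \<le> n" "x \<in> stable_complement" "range T \<subseteq> TT" "\<epsilon> * p x < p (trajectory T x n)"
      using bad by blast
    have "p x \<noteq> 0"
      using *(4) p_trajectory_mono[OF *(3), of 0 n x] by auto
    then have pos: "p x > 0" using energy_norm_nonneg[OF pd, of x] by linarith
    define u where "u = (1 / p x) *\<^sub>R x"
    have "\<epsilon> \<le> p (trajectory T u n)"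
      using *(4) pos by (simp add: u_def trajectory_scaleR energy_norm_scaleR[OF pd] field_simps)
    also have "\<dots> \<le> p (trajectory T u N)" by (rule p_trajectory_mono) (use * in auto)
    finally have "\<epsilon> \<le> p (trajectory T u N)" .
    moreover have "p u = 1" using pos by (simp add: u_def energy_norm_scaleR[OF pd])
    moreover have "u \<in> stable_complement" using *(2) by (simp add: u_def stable_complement_def)
    ultimately show ?thesis using *(3) by blast
  qed
  then obtain u T where u: "\<And>N. u N \<in> stable_complement" "\<And>N. p (u N) = 1"
    and T: "\<And>N. range (T N) \<subseteq> TT" "\<And>N. \<epsilon> \<le> p (trajectory (T N) (u N) N)" by metis
  obtain l r where r: "strict_mono r" "(u \<circ> r) \<longlonglongrightarrow> l"
    by (rule bounded_sequence_limit[of u 1]) (use u in auto)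
  have l: "l \<in> stable_complement"
    by (rule closed_sequentially[OF closed_stable_complement _ r(2)]) (use u in auto)
  have "persistent (\<epsilon> / 2) l" by (rule persistent_limit[OF T r]) (use \<open>\<epsilon> > 0\<close> in simp)
  then obtain S where S: "range S \<subseteq> TT" "\<And>k. \<epsilon> / 2 / 2 \<le> p (trajectory S l k)"
    by (rule persistent_trajectory) (use \<open>\<epsilon> > 0\<close> in auto)
  obtain xbar where x: "xbar \<in> E" "trajectory S l \<longlonglongrightarrow> xbar" using convergent[OF S(1)] by blast
  have "xbar \<in> stable_complement"
    by (rule closed_sequentially[OF closed_stable_complement _ x(2)])
      (use stable_complement_invariant[OF l S(1)] in auto)
  then have "p xbar = 0" using x(1) by (simp add: stable_complement_def energy_norm_def)
  moreover have "\<epsilon> / 2 / 2 \<le> p xbar"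
    using S(2) by (intro LIMSEQ_le_const[OF tendsto_energy_norm[OF pd x(2)]]) auto
  ultimately show False using \<open>\<epsilon> > 0\<close> by simp
qed

text \<open>Subtracting the equilibrium \<open>P e\<close> leaves a trajectory \<open>v\<close> orthogonal to \<open>E\<close>. Its squared
  energy norm for the inverse \<open>R\<close> of \<open>P\<close> at time \<open>n\<close> is the pairing of \<open>v n\<close> with \<open>x = R (v n)\<close>;
  by duality this is the pairing of \<open>v 0\<close> with an \<open>n\<close>-step trajectory starting at \<open>x\<close>,
  which is small relative to \<open>x\<close> by uniform decay.\<close>

theorem transpose_convergent:
  assumes T: "\<And>k. T k \<in> TT" and y: "\<And>k. y (Suc k) = transpose (T k) *v y k"
  shows "\<exists>e\<in>E. y \<longlonglongrightarrow> P *v e"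
proof -
  obtain R where R: "positive_definite R" "\<And>x. R *v (P *v x) = x" "\<And>x. P *v (R *v x) = x"
    using positive_definite_inverse[OF pd] by metis
  obtain e z where e: "e \<in> E" and z: "\<And>d. d \<in> E \<Longrightarrow> z \<bullet> (P *v d) = 0" and ez: "R *v y 0 = e + z"
    using positive_definite_decomposition[OF pd subspace_E, of "R *v y 0"] by blast
  define v where "v k = y k - P *v e" for k
  have v0: "v 0 = P *v z"
    using arg_cong[OF ez, of "\<lambda>x. P *v x"] by (simp add: v_def R matrix_vector_right_distrib)
  have v: "v (Suc k) = transpose (T k) *v v k" for k
    by (simp add: v_def y matrix_vector_mult_diff_distrib transpose_fixed[OF T e])
  have perp: "v n \<bullet> d = 0" if "d \<in> E" for n d
  proof (induction n)
    case 0
    show ?case using z[OF that] positive_definite_sym[OF pd, of z d] by (simp add: v0 inner_commute)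
  next
    case (Suc n)
    have "v (Suc n) \<bullet> d = (T n *v d) \<bullet> v n"
      by (simp add: v inner_matrix_vector_transpose inner_commute[of d])
    then show ?case using Suc fixed[OF T that] by (simp add: inner_commute)
  qed
  have small: "\<exists>N. \<forall>n\<ge>N. p (R *v v n) \<le> \<epsilon> * p z" if "\<epsilon> > 0" for \<epsilon>
  proof -
    obtain N where N: "\<And>n x T. N \<le> n \<Longrightarrow> x \<in> stable_complement \<Longrightarrow> range T \<subseteq> TT \<Longrightarrow> p (trajectory T x n) \<le> \<epsilon> * p x"
      using uniform_decay[OF \<open>\<epsilon> > 0\<close>] by metis
    have "p (R *v v n) \<le> \<epsilon> * p z" if "n \<ge> N" for n
    proof (cases "p (R *v v n) = 0")
      case True
      then show ?thesis using \<open>\<epsilon> > 0\<close> energy_norm_nonneg[OF pd, of z] by simp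
    next
      case False
      define x where "x = R *v v n"
      have "x \<in> stable_complement"
      proof -
        have "x \<bullet> (P *v d) = d \<bullet> v n" for d
          using positive_definite_sym[OF pd, of x d] by (simp add: x_def R)
        then show ?thesis using perp by (simp add: stable_complement_def inner_commute)
      qed
      define w where "w = trajectory (\<lambda>i. T (n - Suc i)) x n"
      have w: "p w \<le> \<epsilon> * p x"
        unfolding w_def by (rule N[OF that \<open>x \<in> stable_complement\<close>]) (use T in auto)
      have "(p x)\<^sup>2 = x \<bullet> v n" by (simp add: energy_norm_sq[OF pd]) (simp add: x_def R)
      also have "\<dots> = w \<bullet> (P *v z)" using trajectory_transpose[of v T, OF v] by (simp add: w_def v0)
      also have "\<dots> \<le> p w * p z" by (rule energy_norm_Cauchy_Schwarz[OF pd])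
      also have "\<dots> \<le> \<epsilon> * p x * p z" by (rule mult_right_mono[OF w energy_norm_nonneg[OF pd]])
      finally have "p x * p x \<le> p x * (\<epsilon> * p z)" by (simp add: power2_eq_square mult_ac)
      moreover have "p x > 0" using False energy_norm_nonneg[OF pd, of x] by (simp add: x_def)
      ultimately show ?thesis unfolding x_def[symmetric] by simp
    qed
    then show ?thesis by blast
  qed
  have "(\<lambda>n. p (R *v v n)) \<longlonglongrightarrow> 0"
  proof (rule LIMSEQ_I)
    fix \<epsilon> :: real assume "\<epsilon> > 0"
    have nz: "0 \<le> p z" by (rule energy_norm_nonneg[OF pd])
    define \<delta> where "\<delta> = \<epsilon> / (2 * (p z + 1))"
    have "\<delta> > 0" using \<open>\<epsilon> > 0\<close> nz by (simp add: \<delta>_def)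
    have "\<delta> * p z < \<epsilon>"
    proof -
      have "\<delta> * p z \<le> \<delta> * (p z + 1)" using \<open>\<delta> > 0\<close> by simp
      also have "\<dots> = \<epsilon> / 2" using nz by (simp add: \<delta>_def field_simps)
      finally show ?thesis using \<open>\<epsilon> > 0\<close> by linarith
    qed
    then show "\<exists>N. \<forall>n\<ge>N. norm (p (R *v v n) - 0) < \<epsilon>"
      using small[OF \<open>\<delta> > 0\<close>] energy_norm_nonneg[OF pd] by (auto intro: order_le_less_trans)
  qed
  then have "(\<lambda>n. R *v v n) \<longlonglongrightarrow> 0" by (rule tendsto_0_if_energy_norm[OF pd])
  then have "(\<lambda>n. P *v (R *v v n)) \<longlonglongrightarrow> P *v 0"
    by (rule bounded_linear.tendsto[OF matrix_vector_mul_bounded_linear])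
  then have "v \<longlonglongrightarrow> 0" by (simp add: R)
  then have "y \<longlonglongrightarrow> P *v e" unfolding v_def by (simp add: LIM_zero_iff)
  with e show ?thesis by blast
qed

end

section \<open>Absolutely continuous functions\<close>

lemma division_interval_endpoints:
  fixes D :: "real set set"
  assumes "D division_of T" "k \<in> D"
  shows "k = {Inf k..Sup k}" "Inf k \<le> Sup k" "Inf k \<in> T" "Sup k \<in> T"
proof -
  obtain u v where uv: "k = {u..v}" and "k \<noteq> {}" "k \<subseteq> T"
    using division_ofD(2,3,4)[OF assms(1)] assms(2) by (metis cbox_interval)
  then have "u \<le> v" by simp
  then show "k = {Inf k..Sup k}" "Inf k \<le> Sup k" "Inf k \<in> T" "Sup k \<in> T"
    using uv \<open>k \<subseteq> T\<close> by auto
qed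

lemma absolutely_continuous_on_subset:
  "absolutely_continuous_on S f \<Longrightarrow> R \<subseteq> S \<Longrightarrow> absolutely_continuous_on R f"
  unfolding absolutely_continuous_on_def by (meson subset_trans)

lemma absolutely_continuous_imp_continuous:
  fixes f :: "real \<Rightarrow> 'a::real_normed_vector"
  assumes "absolutely_continuous_on {a..b} f"
  shows "continuous_on {a..b} f"
  unfolding continuous_on_iff
proof (intro ballI allI impI)
  fix t and \<epsilon> :: real assume t: "t \<in> {a..b}" and "0 < \<epsilon>"
  then obtain \<delta> where \<delta>: "\<delta> > 0" and ac: "\<And>D T. D division_of T \<Longrightarrow> T \<subseteq> {a..b} \<Longrightarrow>
      (\<Sum>k\<in>D. Sup k - Inf k) < \<delta> \<Longrightarrow> (\<Sum>k\<in>D. norm (f (Sup k) - f (Inf k))) < \<epsilon>"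
    using assms unfolding absolutely_continuous_on_def by metis
  have step: "norm (f v - f u) < \<epsilon>" if "u \<le> v" "v - u < \<delta>" "a \<le> u" "v \<le> b" for u v
    using ac[of "{{u..v}}" "{u..v}"] division_of_self[of u v] that by simp
  have "dist (f s) (f t) < \<epsilon>" if "s \<in> {a..b}" "dist s t < \<delta>" for s
    using step[of s t] step[of t s] that t by (cases "s \<le> t") (auto simp: dist_norm norm_minus_commute)
  with \<delta> show "\<exists>d>0. \<forall>s\<in>{a..b}. dist s t < d \<longrightarrow> dist (f s) (f t) < \<epsilon>" by blast
qed

lemma lipschitz_imp_absolutely_continuous:
  fixes f :: "real \<Rightarrow> 'a::real_normed_vector"
  assumes L: "L-lipschitz_on S f"
  shows "absolutely_continuous_on S f"
  unfolding absolutely_continuous_on_def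
proof (intro allI impI)
  fix \<epsilon> :: real assume "0 < \<epsilon>"
  have L0: "0 \<le> L" using L by (rule lipschitz_on_nonneg)
  have "(\<Sum>k\<in>D. norm (f (Sup k) - f (Inf k))) < \<epsilon>"
    if D: "D division_of T \<and> T \<subseteq> S \<and> (\<Sum>k\<in>D. Sup k - Inf k) < \<epsilon> / (L + 1)" for D T
  proof -
    have "norm (f (Sup k) - f (Inf k)) \<le> L * (Sup k - Inf k)" if "k \<in> D" for k
      using division_interval_endpoints[OF conjunct1[OF D] that] D lipschitz_onD[OF L, of "Sup k" "Inf k"]
      by (auto simp: dist_norm)
    then have "(\<Sum>k\<in>D. norm (f (Sup k) - f (Inf k))) \<le> L * (\<Sum>k\<in>D. Sup k - Inf k)"
      by (simp add: sum_distrib_left sum_mono)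
    also have "\<dots> \<le> L * (\<epsilon> / (L + 1))" using D L0 by (intro mult_left_mono) auto
    also have "\<dots> < \<epsilon>" using L0 \<open>0 < \<epsilon>\<close> by (simp add: field_simps)
    finally show ?thesis .
  qed
  moreover have "0 < \<epsilon> / (L + 1)" using L0 \<open>0 < \<epsilon>\<close> by simp
  ultimately show "\<exists>\<delta>>0. \<forall>D T. D division_of T \<and> T \<subseteq> S \<and> (\<Sum>k\<in>D. Sup k - Inf k) < \<delta> \<longrightarrow>
      (\<Sum>k\<in>D. norm (f (Sup k) - f (Inf k))) < \<epsilon>" by blast
qed

text \<open>As in the fundamental theorem for everywhere differentiable functions, intervals tagged at
  points of differentiability contribute a small multiple of their length. Intervals tagged in the
  null set \<open>N\<close> are forced by the gauge into an open set of small measure, and absolute continuity bounds the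
  total increment of \<open>f\<close> over them.\<close>

theorem absolutely_continuous_fundamental_theorem:
  fixes f :: "real \<Rightarrow> 'a::banach"
  assumes "a \<le> b" and ac: "absolutely_continuous_on {a..b} f" and N: "negligible N"
    and deriv: "\<And>t. t \<in> {a..b} - N \<Longrightarrow> (f has_vector_derivative f' t) (at t within {a..b})"
  shows "(f' has_integral (f b - f a)) {a..b}"
proof -
  define g where "g t = (if t \<in> N then 0 else f' t)" for t
  have "(g has_integral (f b - f a)) {a..b}"
  proof (cases "a = b")
    case False
    with \<open>a \<le> b\<close> have "a < b" by simp
    show ?thesis unfolding has_integral_factor_content_real
    proof (intro allI impI)
      fix e :: real assume "e > 0"
      then have "0 < e / 2 * (b - a)" using \<open>a < b\<close> by simp
      then obtain \<delta> where \<delta>: "\<delta> > 0" and acD: "\<And>D T. D division_of T \<Longrightarrow> T \<subseteq> {a..b} \<Longrightarrow>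
          (\<Sum>k\<in>D. Sup k - Inf k) < \<delta> \<Longrightarrow> (\<Sum>k\<in>D. norm (f (Sup k) - f (Inf k))) < e / 2 * (b - a)"
        using ac unfolding absolutely_continuous_on_def by metis
      have Nnull: "N \<in> null_sets lebesgue" using N by (simp add: negligible_iff_null_sets)
      then obtain U where U: "open U" "N \<subseteq> U" "U - N \<in> lmeasurable" "emeasure lebesgue (U - N) < ennreal \<delta>"
        using sets_lebesgue_outer_open[of N \<delta>] \<delta> by (metis null_setsD2)
      have emU: "emeasure lebesgue U < ennreal \<delta>"
        using U(4) emeasure_Diff_null_set[OF Nnull, of U] U(1) by simp
      have lmU: "U \<in> lmeasurable"
        using emU U(1) by (intro fmeasurableI) (auto intro: order_less_trans)
      have mU: "measure lebesgue U < \<delta>"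
        using emU \<delta> by (simp add: emeasure_eq_measure2[OF lmU] ennreal_less_iff)
      have "\<forall>t. \<exists>d>0. t \<in> {a..b} - N \<longrightarrow> (\<forall>y\<in>{a..b}. norm (y - t) < d \<longrightarrow>
          norm (f y - f t - (y - t) *\<^sub>R f' t) \<le> (e / 2) * norm (y - t))"
        using deriv \<open>e > 0\<close> unfolding has_vector_derivative_def has_derivative_within_alt
        by (metis half_gt_zero zero_less_one)
      then obtain d where d: "\<And>t. 0 < d t" "\<And>t y. t \<in> {a..b} - N \<Longrightarrow> y \<in> {a..b} \<Longrightarrow> norm (y - t) < d t \<Longrightarrow>
          norm (f y - f t - (y - t) *\<^sub>R f' t) \<le> (e / 2) * norm (y - t)"
        by metis
      define \<gamma> where "\<gamma> t = (if t \<in> N then U else ball t (d t))" for t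
      have "gauge \<gamma>" using d(1) U(1,2) by (auto simp: gauge_def \<gamma>_def)
      moreover have "norm ((\<Sum>(x,k)\<in>p. measure lborel k *\<^sub>R g x) - (f b - f a)) \<le> e * measure lborel {a..b}"
        if p: "p tagged_division_of {a..b}" and fine: "\<gamma> fine p" for p
      proof -
        define q where "q = {(x, k) \<in> p. x \<in> N}"
        have fin: "finite p" using p by auto
        have qp: "q \<subseteq> p" by (auto simp: q_def)
        have ep: "k = {Inf k..Sup k}" "Inf k \<le> Sup k" "Inf k \<in> {a..b}" "Sup k \<in> {a..b}" if "(x, k) \<in> p" for x k
          using division_interval_endpoints[OF division_of_tagged_division[OF p], of k] that by force+
        have total: "f b - f a = (\<Sum>(x,k)\<in>p. f (Sup k) - f (Inf k))"
          using additive_tagged_division_1[OF \<open>a \<le> b\<close> p, of f] by simp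
        have len: "b - a = (\<Sum>(x,k)\<in>p. Sup k - Inf k)"
          using additive_tagged_division_1[OF \<open>a \<le> b\<close> p, of "\<lambda>x. x"] by simp
        have reg: "norm (measure lborel k *\<^sub>R g x - (f (Sup k) - f (Inf k))) \<le> (e / 2) * (Sup k - Inf k)"
          if xk: "(x, k) \<in> p - q" for x k
        proof -
          define u v where "u = Inf k" and "v = Sup k"
          have k: "k = {u..v}" "u \<le> v" "u \<in> {a..b}" "v \<in> {a..b}" using ep[of x k] xk by (auto simp: u_def v_def)
          have x: "x \<in> k" "x \<in> {a..b}" "x \<notin> N"
            using xk tagged_division_ofD(2,3)[OF p, of x k] by (auto simp: q_def)
          have "k \<subseteq> \<gamma> x" using fine xk by (auto simp: fine_def)
          then have "k \<subseteq> ball x (d x)" using x(3) by (simp add: \<gamma>_def)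
          moreover have "u \<in> k" "v \<in> k" using k by auto
          ultimately have uv: "norm (u - x) < d x" "norm (v - x) < d x"
            by (auto simp: dist_real_def abs_minus_commute)
          have "norm (measure lborel k *\<^sub>R g x - (f v - f u))
              = norm ((f u - f x - (u - x) *\<^sub>R f' x) - (f v - f x - (v - x) *\<^sub>R f' x))"
            using k x by (simp add: g_def algebra_simps)
          also have "\<dots> \<le> norm (f u - f x - (u - x) *\<^sub>R f' x) + norm (f v - f x - (v - x) *\<^sub>R f' x)"
            by (rule norm_triangle_ineq4)
          also have "\<dots> \<le> (e / 2) * norm (u - x) + (e / 2) * norm (v - x)"
            using x k uv by (intro add_mono d(2)) auto
          also have "\<dots> = (e / 2) * (v - u)" using x(1) k(1) by (simp add: field_simps)
          finally show ?thesis by (simp add: u_def v_def)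
        qed
        have sing: "(\<Sum>(x,k)\<in>q. norm (f (Sup k) - f (Inf k))) < e / 2 * (b - a)"
        proof -
          define D where "D = snd ` q"
          have qdiv: "q tagged_division_of (\<Union>D)"
            unfolding D_def using p qp
            by (meson tagged_division_of_def tagged_partial_division_of_Union_self tagged_partial_division_subset)
          then have D: "D division_of (\<Union>D)" unfolding D_def by (rule division_of_tagged_division)
          have Dab: "\<Union>D \<subseteq> {a..b}" using tagged_division_ofD(3)[OF p] qp by (force simp: D_def)
          have DU: "\<Union>D \<subseteq> U" using fine by (force simp: D_def q_def fine_def \<gamma>_def)
          have "(\<Sum>k\<in>D. Sup k - Inf k) = (\<Sum>k\<in>D. measure lebesgue k)"
          proof (rule sum.cong[OF refl])
            fix k assume "k \<in> D"
            then have k: "k = {Inf k..Sup k}" "Inf k \<le> Sup k" using division_interval_endpoints[OF D] by blast+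
            have "measure lebesgue {Inf k..Sup k} = Sup k - Inf k" using k(2) by simp
            then show "Sup k - Inf k = measure lebesgue k" by (simp only: k(1)[symmetric])
          qed
          also have "\<dots> = measure lebesgue (\<Union>D)" by (rule content_division[OF D])
          also have "\<dots> \<le> measure lebesgue U"
            using DU lmU lmeasurable_division[OF D] by (intro measure_mono_fmeasurable) auto
          finally have "(\<Sum>k\<in>D. norm (f (Sup k) - f (Inf k))) < e / 2 * (b - a)"
            using mU by (intro acD[OF D Dab]) simp
          moreover have "(\<Sum>(x,k)\<in>q. norm (f (Sup k) - f (Inf k))) = (\<Sum>k\<in>D. norm (f (Sup k) - f (Inf k)))"
          proof -
            \<comment> \<open>\<open>Sup {}\<close> and \<open>Inf {}\<close> need not agree, so the empty interval is set to zero by hand; it does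
              not occur in a tagged division.\<close>
            define \<Delta> where "\<Delta> k = (if k = {} then 0 else norm (f (Sup k) - f (Inf k)))" for k
            have ne: "k \<noteq> {}" if "(x, k) \<in> q" for x k
              using tagged_division_ofD(2)[OF qdiv that] by blast
            have "(\<Sum>(x,k)\<in>q. \<Delta> k) = sum \<Delta> D" unfolding D_def
            proof (rule sum.over_tagged_division_lemma[OF qdiv])
              fix u v :: real assume "box u v = {}"
              then show "\<Delta> (cbox u v) = 0" by (cases "u = v") (auto simp: \<Delta>_def)
            qed
            moreover have "(\<Sum>(x,k)\<in>q. \<Delta> k) = (\<Sum>(x,k)\<in>q. norm (f (Sup k) - f (Inf k)))"
              by (rule sum.cong[OF refl]) (auto simp: \<Delta>_def dest: ne)
            moreover have "sum \<Delta> D = (\<Sum>k\<in>D. norm (f (Sup k) - f (Inf k)))"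
              by (rule sum.cong[OF refl]) (use ne in \<open>auto simp: \<Delta>_def D_def\<close>)
            ultimately show ?thesis by simp
          qed
          ultimately show ?thesis by simp
        qed
        have "norm ((\<Sum>(x,k)\<in>p. measure lborel k *\<^sub>R g x) - (f b - f a))
            = norm (\<Sum>(x,k)\<in>p. measure lborel k *\<^sub>R g x - (f (Sup k) - f (Inf k)))"
          unfolding total by (simp add: sum_subtractf split_def)
        also have "\<dots> \<le> (\<Sum>(x,k)\<in>p. norm (measure lborel k *\<^sub>R g x - (f (Sup k) - f (Inf k))))"
          using norm_sum[of "\<lambda>(x,k). measure lborel k *\<^sub>R g x - (f (Sup k) - f (Inf k))" p] by (simp add: split_def)
        also have "\<dots> = (\<Sum>(x,k)\<in>p - q. norm (measure lborel k *\<^sub>R g x - (f (Sup k) - f (Inf k))))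
            + (\<Sum>(x,k)\<in>q. norm (measure lborel k *\<^sub>R g x - (f (Sup k) - f (Inf k))))"
          by (rule sum.subset_diff[OF qp fin])
        also have "(\<Sum>(x,k)\<in>q. norm (measure lborel k *\<^sub>R g x - (f (Sup k) - f (Inf k)))) = (\<Sum>(x,k)\<in>q. norm (f (Sup k) - f (Inf k)))"
          by (rule sum.cong[OF refl]) (auto simp: q_def g_def norm_minus_commute)
        also have "(\<Sum>(x,k)\<in>p - q. norm (measure lborel k *\<^sub>R g x - (f (Sup k) - f (Inf k)))) \<le> (\<Sum>(x,k)\<in>p - q. (e / 2) * (Sup k - Inf k))"
          using reg by (intro sum_mono) auto
        also have "\<dots> \<le> (\<Sum>(x,k)\<in>p. (e / 2) * (Sup k - Inf k))"
          using fin ep \<open>e > 0\<close> by (intro sum_mono2) (auto intro!: mult_nonneg_nonneg)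
        also have "\<dots> = e / 2 * (b - a)" by (simp add: len sum_distrib_left split_def)
        finally show ?thesis using sing \<open>a < b\<close> by (simp add: field_simps)
      qed
      ultimately show "\<exists>\<gamma>. gauge \<gamma> \<and> (\<forall>p. p tagged_division_of {a..b} \<and> \<gamma> fine p \<longrightarrow>
          norm ((\<Sum>(x,k)\<in>p. measure lborel k *\<^sub>R g x) - (f b - f a)) \<le> e * measure lborel {a..b})"
        by (intro exI[of _ \<gamma>] conjI allI impI) simp_all
    qed
  qed (use has_integral_refl(2)[of g b] in simp)
  then show ?thesis by (rule has_integral_spike[OF N, rotated]) (simp add: g_def)
qed

lemma lipschitz_nonincreasing:
  fixes g :: "real \<Rightarrow> real"
  assumes "a \<le> b" and L: "L-lipschitz_on {a..b} g" and N: "negligible N"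
    and deriv: "\<And>t. t \<in> {a<..<b} - N \<Longrightarrow> (g has_vector_derivative g' t) (at t) \<and> g' t \<le> 0"
  shows "g b \<le> g a"
proof -
  define M where "M = N \<union> {a, b}"
  define h where "h t = (if t \<in> M then 0 else g' t)" for t
  have "negligible M" using N by (simp add: M_def)
  then have "(h has_integral (g b - g a)) {a..b}"
  proof (rule absolutely_continuous_fundamental_theorem[OF \<open>a \<le> b\<close> lipschitz_imp_absolutely_continuous[OF L]])
    fix t assume "t \<in> {a..b} - M"
    then have "t \<in> {a<..<b} - N" "h t = g' t" by (auto simp: M_def h_def)
    with deriv show "(g has_vector_derivative h t) (at t within {a..b})"
      by (auto intro: has_vector_derivative_at_within)
  qed
  moreover have "h t \<le> 0" if "t \<in> {a..b}" for t
    using deriv[of t] that by (auto simp: h_def M_def)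
  ultimately have "g b - g a \<le> 0"
    using has_integral_le[OF _ has_integral_0] by blast
  then show ?thesis by simp
qed

section \<open>Linear equations with time-dependent coefficients\<close>

lemma lipschitz_inner:
  fixes f g :: "real \<Rightarrow> 'a::real_inner"
  assumes f: "K-lipschitz_on {a..b} f" and g: "L-lipschitz_on {a..b} g"
  shows "\<exists>M. M-lipschitz_on {a..b} (\<lambda>t. f t \<bullet> g t)"
proof -
  have bdd: "\<exists>C\<ge>0. \<forall>t\<in>{a..b}. norm (h t) \<le> C" if "C'-lipschitz_on {a..b} h" for h :: "real \<Rightarrow> 'a" and C'
  proof -
    have "bounded (h ` {a..b})"
      using lipschitz_on_continuous_on[OF that] by (intro compact_imp_bounded compact_continuous_image) auto
    then show ?thesis unfolding bounded_pos by (meson imageI less_imp_le)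
  qed
  obtain F where F: "F \<ge> 0" "\<And>t. t \<in> {a..b} \<Longrightarrow> norm (f t) \<le> F" using bdd[OF f] by blast
  obtain G where G: "G \<ge> 0" "\<And>t. t \<in> {a..b} \<Longrightarrow> norm (g t) \<le> G" using bdd[OF g] by blast
  have K: "0 \<le> K" and L: "0 \<le> L" using f g lipschitz_on_nonneg by auto
  have "(K * G + F * L)-lipschitz_on {a..b} (\<lambda>t. f t \<bullet> g t)"
  proof (rule lipschitz_onI)
    show "0 \<le> K * G + F * L" using F G K L by simp
    fix s t assume st: "s \<in> {a..b}" "t \<in> {a..b}"
    have "f s \<bullet> g s - f t \<bullet> g t = (f s - f t) \<bullet> g s + f t \<bullet> (g s - g t)"
      by (simp add: inner_diff_left inner_diff_right)
    also have "\<bar>\<dots>\<bar> \<le> norm (f s - f t) * norm (g s) + norm (f t) * norm (g s - g t)"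
      by (intro order_trans[OF abs_triangle_ineq] add_mono Cauchy_Schwarz_ineq2)
    also have "\<dots> \<le> (K * dist s t) * G + F * (L * dist s t)"
      using st F G K L lipschitz_onD[OF f st] lipschitz_onD[OF g st]
      by (intro add_mono mult_mono) (auto simp: dist_norm)
    finally show "dist (f s \<bullet> g s) (f t \<bullet> g t) \<le> (K * G + F * L) * dist s t"
      by (simp add: dist_real_def algebra_simps)
  qed
  then show ?thesis by blast
qed

lemma lipschitz_matrix_vector:
  fixes f :: "real \<Rightarrow> real^'n"
  assumes "K-lipschitz_on S f"
  shows "\<exists>M. M-lipschitz_on S (\<lambda>t. (Q :: real^'n^'m) *v f t)"
proof -
  obtain C where "C-lipschitz_on (f ` S) ((*v) Q)"
    using bounded_linear.lipschitz_boundE[OF matrix_vector_mul_bounded_linear] by blast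
  from lipschitz_on_compose2[OF assms this] show ?thesis by blast
qed

text \<open>A solution of \<open>x' = B(t) x\<close> almost everywhere on an interval. With bounded coefficients,
  absolutely continuous solutions are Lipschitz continuous, and the Lipschitz condition is the one
  that is easily seen to survive products and time reversal. Only interior points are considered, so that
  derivatives are two-sided.\<close>

definition solves :: "(real \<Rightarrow> real^'n^'n) \<Rightarrow> real \<Rightarrow> real \<Rightarrow> (real \<Rightarrow> real^'n) \<Rightarrow> bool" where
  "solves B a b x \<longleftrightarrow> (\<exists>L. L-lipschitz_on {a..b} x) \<and>
    (\<exists>N. negligible N \<and> (\<forall>t\<in>{a<..<b} - N. (x has_vector_derivative B t *v x t) (at t)))"

lemma solves_cong:
  assumes "solves B a b x" "\<And>t. a < t \<Longrightarrow> t < b \<Longrightarrow> B t = C t"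
  shows "solves C a b x"
  using assms unfolding solves_def by (metis Diff_iff greaterThanLessThan_iff)

lemma solves_subset:
  assumes "solves B a b x" "a \<le> c" "d \<le> b"
  shows "solves B c d x"
proof -
  have "{c..d} \<subseteq> {a..b}" "{c<..<d} \<subseteq> {a<..<b}" using assms by auto
  then show ?thesis using assms(1) unfolding solves_def by (meson lipschitz_on_subset Diff_iff subsetD)
qed

text \<open>Used with \<open>\<sigma> = 1\<close> for shifting time and \<open>\<sigma> = -1\<close> for reversing it.\<close>

lemma lipschitz_ae_derivative_affine:
  fixes x :: "real \<Rightarrow> 'a::real_normed_vector"
  assumes L: "L-lipschitz_on {a..b} x" and N: "negligible N"
    and d: "\<And>t. t \<in> {a<..<b} - N \<Longrightarrow> (x has_vector_derivative x' t) (at t)"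
    and \<sigma>: "\<bar>\<sigma>\<bar> = (1::real)"
    and maps: "(\<lambda>t. \<sigma> * t + c) ` {a'..b'} \<subseteq> {a..b}" "(\<lambda>t. \<sigma> * t + c) ` {a'<..<b'} \<subseteq> {a<..<b}"
  obtains N' where "L-lipschitz_on {a'..b'} (\<lambda>t. x (\<sigma> * t + c))" "negligible N'"
    "\<And>t. t \<in> {a'<..<b'} - N' \<Longrightarrow>
      ((\<lambda>t. x (\<sigma> * t + c)) has_vector_derivative \<sigma> *\<^sub>R x' (\<sigma> * t + c)) (at t)"
proof -
  define N' where "N' = (\<lambda>s. \<sigma> * (s - c)) ` N"
  have ss: "\<sigma> * \<sigma> = 1" using \<sigma> by (metis abs_mult_self_eq mult.right_neutral)
  have "dist (x (\<sigma> * s + c)) (x (\<sigma> * t + c)) \<le> L * dist s t" if "s \<in> {a'..b'}" "t \<in> {a'..b'}" for s t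
  proof -
    have "dist (\<sigma> * s + c) (\<sigma> * t + c) = \<bar>\<sigma>\<bar> * dist s t"
      by (simp add: dist_real_def abs_mult[symmetric] right_diff_distrib)
    moreover have "\<sigma> * s + c \<in> {a..b}" "\<sigma> * t + c \<in> {a..b}" using maps(1) that by blast+
    ultimately show ?thesis using lipschitz_onD[OF L, of "\<sigma> * s + c" "\<sigma> * t + c"] \<sigma> by simp
  qed
  then have "L-lipschitz_on {a'..b'} (\<lambda>t. x (\<sigma> * t + c))"
    using lipschitz_on_nonneg[OF L] by (intro lipschitz_onI)
  moreover have "negligible N'" unfolding N'_def
    by (rule negligible_differentiable_image_negligible[OF order_refl N]) (intro derivative_intros)
  moreover have "((\<lambda>t. x (\<sigma> * t + c)) has_vector_derivative \<sigma> *\<^sub>R x' (\<sigma> * t + c)) (at t)"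
    if t: "t \<in> {a'<..<b'} - N'" for t
  proof -
    have "\<sigma> * t + c \<notin> N"
    proof
      assume "\<sigma> * t + c \<in> N"
      moreover have "t = \<sigma> * (\<sigma> * t + c - c)" by (simp add: mult.assoc[symmetric] ss)
      ultimately show False using t unfolding N'_def by blast
    qed
    moreover have "\<sigma> * t + c \<in> {a<..<b}" using maps(2) t by blast
    ultimately have "(x has_vector_derivative x' (\<sigma> * t + c)) (at (\<sigma> * t + c))"
      by (intro d) blast
    moreover have "((\<lambda>t. \<sigma> * t + c) has_vector_derivative \<sigma>) (at t)"
      by (auto intro!: derivative_eq_intros)
    ultimately show ?thesis using vector_diff_chain_at[of "\<lambda>t. \<sigma> * t + c" \<sigma> t x] by (simp add: o_def)
  qed
  ultimately show ?thesis by (rule that)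
qed

lemma solves_shift:
  assumes "solves B (a + c) (b + c) x"
  shows "solves (\<lambda>t. B (t + c)) a b (\<lambda>t. x (t + c))"
proof -
  obtain L N where L: "L-lipschitz_on {a + c..b + c} x" and N: "negligible N"
    and d: "\<And>t. t \<in> {a + c<..<b + c} - N \<Longrightarrow> (x has_vector_derivative B t *v x t) (at t)"
    using assms unfolding solves_def by blast
  show ?thesis
    by (rule lipschitz_ae_derivative_affine[OF L N d, of 1 c a b]) (auto simp: solves_def)
qed

lemma solves_diff:
  assumes x: "solves B a b x" and y: "solves B a b y"
  shows "solves B a b (\<lambda>t. x t - y t)"
proof -
  obtain K N where K: "K-lipschitz_on {a..b} x" and N: "negligible N"
    and dx: "\<And>t. t \<in> {a<..<b} - N \<Longrightarrow> (x has_vector_derivative B t *v x t) (at t)"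
    using x unfolding solves_def by blast
  obtain L M where L: "L-lipschitz_on {a..b} y" and M: "negligible M"
    and dy: "\<And>t. t \<in> {a<..<b} - M \<Longrightarrow> (y has_vector_derivative B t *v y t) (at t)"
    using y unfolding solves_def by blast
  have "((\<lambda>t. x t - y t) has_vector_derivative B t *v (x t - y t)) (at t)"
    if "t \<in> {a<..<b} - (N \<union> M)" for t
    using has_vector_derivative_diff[OF dx dy] that by (simp add: matrix_vector_mult_diff_distrib)
  moreover have "negligible (N \<union> M)" using N M by simp
  ultimately show ?thesis using lipschitz_on_diff[OF K L] unfolding solves_def by blast
qed

lemma solves_const:
  assumes "\<And>t. B t *v v = 0"
  shows "solves B a b (\<lambda>t. v)"
  unfolding solves_def using assms by (auto intro!: exI[of _ 0] exI[of _ "{}"] lipschitz_onI)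

lemma solves_energy_decreasing:
  assumes x: "solves B a b x" and "a \<le> b" and sym: "transpose P = P"
    and diss: "\<And>t v. a < t \<Longrightarrow> t < b \<Longrightarrow> v \<bullet> ((transpose (B t) ** P + P ** B t) *v v) \<le> 0"
  shows "x b \<bullet> (P *v x b) \<le> x a \<bullet> (P *v x a)"
proof -
  obtain L N where L: "L-lipschitz_on {a..b} x" and N: "negligible N"
    and d: "\<And>t. t \<in> {a<..<b} - N \<Longrightarrow> (x has_vector_derivative B t *v x t) (at t)"
    using x unfolding solves_def by blast
  obtain M where M: "M-lipschitz_on {a..b} (\<lambda>t. x t \<bullet> (P *v x t))"
    using lipschitz_inner[OF L] lipschitz_matrix_vector[OF L, of P] by blast
  have "((\<lambda>t. x t \<bullet> (P *v x t)) has_vector_derivative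
      x t \<bullet> (P *v (B t *v x t)) + (B t *v x t) \<bullet> (P *v x t)) (at t)" if "t \<in> {a<..<b} - N" for t
    by (rule bounded_bilinear.has_vector_derivative[OF bounded_bilinear_inner d[OF that]
        bounded_linear.has_vector_derivative[OF matrix_vector_mul_bounded_linear d[OF that]]])
  moreover have "x t \<bullet> (P *v (B t *v x t)) + (B t *v x t) \<bullet> (P *v x t) \<le> 0" if "t \<in> {a<..<b} - N" for t
    using diss[of t "x t"] that
    by (simp add: matrix_vector_mult_add_rdistrib inner_add_right inner_matrix_vector_transpose
        matrix_vector_mul_assoc[symmetric])
  ultimately show ?thesis by (intro lipschitz_nonincreasing[OF \<open>a \<le> b\<close> M N]) blast
qed

text \<open>The two equations are arranged so that \<open>x (1 - t) \<bullet> y t\<close> has derivative zero almost everywhere.\<close>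

lemma solves_adjoint:
  assumes x: "solves B 0 1 x" and y: "solves (\<lambda>t. transpose (B (1 - t))) 0 1 y"
  shows "x 1 \<bullet> y 0 = x 0 \<bullet> y 1"
proof -
  define z where "z t = x (1 - t)" for t
  obtain K N0 where K0: "K-lipschitz_on {0..1} x" and N0: "negligible N0"
    and dx: "\<And>t. t \<in> {0<..<1} - N0 \<Longrightarrow> (x has_vector_derivative B t *v x t) (at t)"
    using x unfolding solves_def by blast
  obtain N where K: "K-lipschitz_on {0..1} z" and N: "negligible N"
    and dz: "\<And>t. t \<in> {0<..<1} - N \<Longrightarrow> (z has_vector_derivative - (B (1 - t) *v z t)) (at t)"
    by (rule lipschitz_ae_derivative_affine[OF K0 N0 dx, of "-1" 1 0 1]) (auto simp: z_def[abs_def])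
  obtain L M where L: "L-lipschitz_on {0..1} y" and M: "negligible M"
    and dy: "\<And>t. t \<in> {0<..<1} - M \<Longrightarrow> (y has_vector_derivative transpose (B (1 - t)) *v y t) (at t)"
    using y unfolding solves_def by blast
  have NM: "negligible (N \<union> M)" using N M by simp
  obtain C where C: "C-lipschitz_on {0..1} (\<lambda>t. z t \<bullet> y t)" using lipschitz_inner[OF K L] by blast
  have der: "((\<lambda>t. z t \<bullet> y t) has_vector_derivative 0) (at t)" if "t \<in> {0<..<1} - (N \<union> M)" for t
    using bounded_bilinear.has_vector_derivative[OF bounded_bilinear_inner dz dy, of t] that
    by (simp add: inner_matrix_vector_transpose)
  have "z 1 \<bullet> y 1 \<le> z 0 \<bullet> y 0"
    by (rule lipschitz_nonincreasing[OF _ C NM, where g' = "\<lambda>_. 0"]) (use der in auto)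
  moreover have "- (z 1 \<bullet> y 1) \<le> - (z 0 \<bullet> y 0)"
    by (rule lipschitz_nonincreasing[OF _ lipschitz_on_minus[OF C] NM, where g' = "\<lambda>_. 0"])
      (use has_vector_derivative_minus[OF der] in auto)
  ultimately show ?thesis by (simp add: z_def)
qed

text \<open>Lebesgue differentiation: applying the one-sided statement to \<open>f\<close> gives the right derivative of
  the integral, applying it to the reflection \<open>\<lambda>s. f (- s)\<close> the left derivative.\<close>

lemma indefinite_integral_ae_derivative:
  fixes f :: "real \<Rightarrow> 'a::euclidean_space"
  assumes int: "\<And>a b. f integrable_on {a..b}"
  obtains N where "negligible N"
    "\<And>t. t > 0 \<Longrightarrow> t \<notin> N \<Longrightarrow> ((\<lambda>u. integral {0..u} f) has_vector_derivative f t) (at t)"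
proof -
  have "f integrable_on cbox a b" for a b using int by simp
  from integrable_ccontinuous_explicit[OF this]
  obtain N1 where N1: "negligible N1"
    and r0: "\<And>x e. x \<notin> N1 \<Longrightarrow> 0 < e \<Longrightarrow> \<exists>d>0. \<forall>h. 0 < h \<and> h < d \<longrightarrow>
      norm (integral (cbox x (x + h *\<^sub>R One)) f /\<^sub>R h ^ DIM(real) - f x) < e"
    by blast
  have r: "\<exists>d>0. \<forall>h. 0 < h \<and> h < d \<longrightarrow> norm (integral {x..x + h} f /\<^sub>R h - f x) < e"
    if "x \<notin> N1" "0 < e" for x e
    using r0[OF that] by simp
  define g where "g s = f (- s)" for s
  have "g integrable_on cbox a b" for a b
    using Henstock_Kurzweil_Integration.integrable_reflect_real[where f = f and a = "-b" and b = "-a"] int by (simp add: g_def[abs_def])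
  from integrable_ccontinuous_explicit[OF this]
  obtain N2 where N2: "negligible N2"
    and l0: "\<And>x e. x \<notin> N2 \<Longrightarrow> 0 < e \<Longrightarrow> \<exists>d>0. \<forall>h. 0 < h \<and> h < d \<longrightarrow>
      norm (integral (cbox x (x + h *\<^sub>R One)) g /\<^sub>R h ^ DIM(real) - g x) < e"
    by blast
  have l: "\<exists>d>0. \<forall>h. 0 < h \<and> h < d \<longrightarrow> norm (integral {x..x + h} g /\<^sub>R h - g x) < e"
    if "x \<notin> N2" "0 < e" for x e
    using l0[OF that] by simp
  define N where "N = N1 \<union> uminus ` N2"
  have "negligible (uminus ` N2)"
    by (rule negligible_differentiable_image_negligible[OF order_refl N2]) (intro derivative_intros)
  then have "negligible N" using N1 by (simp add: N_def)
  moreover have "((\<lambda>u. integral {0..u} f) has_vector_derivative f t) (at t)" if "t > 0" "t \<notin> N" for t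
    unfolding has_vector_derivative_def has_derivative_at_alt
  proof (intro conjI allI impI)
    show "bounded_linear (\<lambda>h. h *\<^sub>R f t)" by (rule bounded_linear_scaleR_left)
    fix e :: real assume "0 < e"
    have "t \<notin> N1" "- t \<notin> N2" using that(2) by (force simp: N_def)+
    obtain d1 where d1: "d1 > 0" "\<And>h. 0 < h \<Longrightarrow> h < d1 \<Longrightarrow> norm (integral {t..t + h} f /\<^sub>R h - f t) < e"
      using r[OF \<open>t \<notin> N1\<close> \<open>0 < e\<close>] by blast
    obtain d2 where d2: "d2 > 0" "\<And>h. 0 < h \<Longrightarrow> h < d2 \<Longrightarrow> norm (integral {- t..- t + h} g /\<^sub>R h - f t) < e"
      using l[OF \<open>- t \<notin> N2\<close> \<open>0 < e\<close>] by (auto simp: g_def)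
    have scale: "norm (I - h *\<^sub>R f t) \<le> e * h" if "0 < h" "norm (I /\<^sub>R h - f t) < e" for I h
    proof -
      have "I - h *\<^sub>R f t = h *\<^sub>R (I /\<^sub>R h - f t)" using that(1) by (simp add: scaleR_diff_right)
      then have "norm (I - h *\<^sub>R f t) = h * norm (I /\<^sub>R h - f t)" using that(1) by simp
      then show ?thesis using that by (simp add: mult.commute)
    qed
    have "norm (integral {0..y} f - integral {0..t} f - (y - t) *\<^sub>R f t) \<le> e * norm (y - t)"
      if y: "norm (y - t) < min t (min d1 d2)" for y
    proof (cases y t rule: linorder_cases)
      case greater
      have "integral {0..t} f + integral {t..y} f = integral {0..y} f"
        using greater \<open>t > 0\<close> int by (intro Henstock_Kurzweil_Integration.integral_combine) auto
      then have "integral {0..y} f - integral {0..t} f = integral {t..y} f" by (metis add_diff_cancel_left')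
      moreover have "norm (integral {t..y} f - (y - t) *\<^sub>R f t) \<le> e * (y - t)"
        using scale[of "y - t" "integral {t..y} f"] d1(2)[of "y - t"] y greater by simp
      ultimately show ?thesis using greater by simp
    next
      case less
      have "integral {0..y} f + integral {y..t} f = integral {0..t} f"
        using less y int by (intro Henstock_Kurzweil_Integration.integral_combine) auto
      then have eq: "integral {0..y} f - integral {0..t} f - (y - t) *\<^sub>R f t
          = - (integral {y..t} f - (t - y) *\<^sub>R f t)" by (simp add: algebra_simps)
      have "integral {- t..- t + (t - y)} g = integral {y..t} f"
        unfolding g_def using Henstock_Kurzweil_Integration.integral_reflect_real[of "-t" "-y" f] by simp
      then have "norm (integral {y..t} f - (t - y) *\<^sub>R f t) \<le> e * (t - y)"
        using scale[of "t - y" "integral {y..t} f"] d2(2)[of "t - y"] y less by simp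
      then show ?thesis unfolding eq norm_minus_cancel using less by simp
    qed simp
    then show "\<exists>d>0. \<forall>y. norm (y - t) < d \<longrightarrow>
        norm (integral {0..y} f - integral {0..t} f - (y - t) *\<^sub>R f t) \<le> e * norm (y - t)"
      using \<open>t > 0\<close> d1(1) d2(1) by (intro exI[of _ "min t (min d1 d2)"]) auto
  qed
  ultimately show ?thesis by (rule that)
qed

section \<open>Existence of solutions for measurable coefficients\<close>

lemma lipschitz_if_bounded_derivative_integral:
  fixes x :: "real \<Rightarrow> 'a::banach"
  assumes int: "\<And>s t. a \<le> s \<Longrightarrow> s \<le> t \<Longrightarrow> t \<le> b \<Longrightarrow> (h has_integral (x t - x s)) {s..t}"
    and bound: "\<And>t. t \<in> {a..b} \<Longrightarrow> norm (h t) \<le> C" and "0 \<le> C"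
  shows "C-lipschitz_on {a..b} x"
proof -
  have le: "norm (x t - x s) \<le> C * (t - s)" if "a \<le> s" "s \<le> t" "t \<le> b" for s t
    using has_integral_bound_real[OF \<open>0 \<le> C\<close> finite.emptyI int[OF that]] bound that by auto
  have "dist (x s) (x t) \<le> C * dist s t" if "s \<in> {a..b}" "t \<in> {a..b}" for s t
  proof (cases "s \<le> t")
    case True
    with le[of s t] that show ?thesis by (simp add: dist_norm norm_minus_commute)
  next
    case False
    with le[of t s] that show ?thesis by (simp add: dist_norm)
  qed
  then show ?thesis using \<open>0 \<le> C\<close> by (intro lipschitz_onI)
qed

primrec picard_term :: "(real \<Rightarrow> real^'n^'n) \<Rightarrow> real^'n \<Rightarrow> nat \<Rightarrow> real \<Rightarrow> real^'n" where
  "picard_term B v 0 t = v"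
| "picard_term B v (Suc n) t = integral {0..t} (\<lambda>s. B s *v picard_term B v n s)"

lemma integrable_matrix_vector:
  fixes B :: "real \<Rightarrow> real^'n^'n"
  assumes meas: "B \<in> borel_measurable lebesgue" and bound: "\<And>t v. norm (B t *v v) \<le> L * norm v"
    and "0 \<le> L" and f: "continuous_on {a..b} f"
  shows "(\<lambda>s. B s *v f s) integrable_on {a..b}"
proof -
  have ab: "{a..b} \<in> sets lebesgue" by simp
  have "bounded (f ` {a..b})" using f by (intro compact_imp_bounded compact_continuous_image) auto
  then obtain C where C: "\<And>t. t \<in> {a..b} \<Longrightarrow> norm (f t) \<le> C"
    unfolding bounded_iff by (meson imageI)
  have "(\<lambda>s. B s *v f s) \<in> borel_measurable (lebesgue_on {a..b})"
  proof (rule borel_measurable_continuous_Pair[where H = "\<lambda>C v. C *v v"])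
    show "B \<in> borel_measurable (lebesgue_on {a..b})" by (rule measurable_restrict_space1[OF meas])
    show "f \<in> borel_measurable (lebesgue_on {a..b})"
      by (rule continuous_imp_measurable_on_sets_lebesgue[OF f ab])
    show "continuous_on UNIV (\<lambda>q. (fst q :: real^'n^'n) *v snd q)"
      unfolding matrix_vector_mult_def
      by (intro continuous_on_vec_lambda continuous_on_sum continuous_on_mult continuous_on_component
          continuous_on_fst continuous_on_snd continuous_on_id)
  qed
  moreover have "norm (B s *v f s) \<le> L * C" if "s \<in> {a..b}" for s
    using bound[of s "f s"] mult_left_mono[OF C[OF that] \<open>0 \<le> L\<close>] by linarith
  ultimately show ?thesis
    by (rule measurable_bounded_by_integrable_imp_integrable[OF _ integrable_const_ivl _ ab])
qed

text \<open>The solution is the sum of the series of iterated integrals. In the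
  weighted norm with weight \<open>exp (2 * L * t)\<close> each integration halves the norm, which makes the series
  converge uniformly on every bounded interval.\<close>

theorem caratheodory_existence:
  fixes B :: "real \<Rightarrow> real^'n^'n" and v :: "real^'n"
  assumes meas: "B \<in> borel_measurable lebesgue" and bound: "\<And>t v. norm (B t *v v) \<le> L * norm v" and "0 < L"
  obtains x N where "x 0 = v" "negligible N"
    "\<And>t. t > 0 \<Longrightarrow> t \<notin> N \<Longrightarrow> (x has_vector_derivative B t *v x t) (at t)"
    "\<And>b. \<exists>K. K-lipschitz_on {0..b} x"
proof -
  define u where "u = picard_term B v"
  have u0: "u 0 t = v" and uSuc: "u (Suc n) t = integral {0..t} (\<lambda>s. B s *v u n s)" for n t
    by (simp_all add: u_def)
  have int: "(\<lambda>s. B s *v f s) integrable_on {a..b}" if "continuous_on {a..b} f" for f a b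
    using integrable_matrix_vector[OF meas bound _ that] \<open>0 < L\<close> by simp
  have u_cont: "continuous_on {0..b} (u n)" for n b
  proof (induction n)
    case (Suc n)
    show ?case unfolding uSuc[abs_def] by (rule indefinite_integral_continuous_1[OF int[OF Suc]])
  qed (simp add: u_def)
  have u_bound: "norm (u n t) \<le> (1/2)^n * norm v * exp (2 * L * t)" if "0 \<le> t" for n t
    using that
  proof (induction n arbitrary: t)
    case 0
    then have "norm v * 1 \<le> norm v * exp (2 * L * t)" using \<open>0 < L\<close> by (intro mult_left_mono) auto
    then show ?case by (simp add: u0)
  next
    case (Suc n)
    define G where "G s = (1/2)^Suc n * norm v * exp (2 * L * s)" for s
    define g where "g s = L * ((1/2)^n * norm v * exp (2 * L * s))" for s
    have G: "(g has_integral (G t - G 0)) {0..t}"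
      by (rule fundamental_theorem_of_calculus[OF Suc.prems])
        (auto simp: G_def g_def has_real_derivative_iff_has_vector_derivative[symmetric] intro!: derivative_eq_intros)
    have le: "norm (B s *v u n s) \<le> g s" if "s \<in> {0..t}" for s
    proof -
      have "L * norm (u n s) \<le> g s"
        unfolding g_def using Suc.IH[of s] that \<open>0 < L\<close> by (intro mult_left_mono) auto
      with bound[of s "u n s"] show ?thesis by linarith
    qed
    have "norm (u (Suc n) t) \<le> integral {0..t} g" unfolding uSuc
      by (rule Henstock_Kurzweil_Integration.integral_norm_bound_integral[OF int[OF u_cont] has_integral_integrable[OF G] le])
    then have "norm (u (Suc n) t) \<le> G t - G 0" by (simp only: integral_unique[OF G])
    moreover have "0 \<le> G 0" by (simp add: G_def)
    ultimately have "norm (u (Suc n) t) \<le> G t" by linarith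
    then show ?case by (simp add: G_def)
  qed
  define x where "x t = (\<Sum>n. u n t)" for t
  define S where "S n t = (\<Sum>i<n. u i t)" for n t
  define M where "M b n = (1/2)^n * norm v * exp (2 * L * b)" for b and n :: nat
  have M_sum: "summable (M b)" for b unfolding M_def by (intro summable_mult2 summable_geometric) simp
  have M_nonneg: "0 \<le> M b n" for b n by (simp add: M_def)
  have uM: "norm (u n t) \<le> M b n" if "t \<in> {0..b}" for n t b
  proof -
    have "2 * L * t \<le> 2 * L * b" using that \<open>0 < L\<close> by (intro mult_left_mono) auto
    then have "(1/2)^n * norm v * exp (2 * L * t) \<le> M b n"
      unfolding M_def by (intro mult_left_mono) simp_all
    with u_bound[of t n] that show ?thesis by simp
  qed
  have lim: "uniform_limit {0..b} S x sequentially" for b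
    unfolding S_def[abs_def] x_def[abs_def] by (rule Weierstrass_m_test[OF uM M_sum])
  have S_cont: "continuous_on {0..b} (S n)" for n b
    unfolding S_def[abs_def] by (intro continuous_on_sum u_cont)
  have x_cont: "continuous_on {0..b} x" for b
    by (rule uniform_limit_theorem[OF always_eventually lim]) (simp_all add: S_cont)
  have S_Suc: "S (Suc n) t = v + integral {0..t} (\<lambda>s. B s *v S n s)" if "0 \<le> t" for n t
  proof (induction n)
    case 0
    then show ?case by (simp add: S_def u0)
  next
    case (Suc n)
    have "S (Suc (Suc n)) t = S (Suc n) t + u (Suc n) t" by (simp add: S_def)
    also have "\<dots> = v + (integral {0..t} (\<lambda>s. B s *v S n s) + integral {0..t} (\<lambda>s. B s *v u n s))"
      using Suc by (simp add: uSuc)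
    also have "integral {0..t} (\<lambda>s. B s *v S n s) + integral {0..t} (\<lambda>s. B s *v u n s)
        = integral {0..t} (\<lambda>s. B s *v S n s + B s *v u n s)"
      by (rule Henstock_Kurzweil_Integration.integral_add[symmetric]) (intro int S_cont u_cont)+
    also have "(\<lambda>s. B s *v S n s + B s *v u n s) = (\<lambda>s. B s *v S (Suc n) s)"
      by (simp add: S_def matrix_vector_right_distrib)
    finally show ?case .
  qed
  have x_eq: "x t = v + integral {0..t} (\<lambda>s. B s *v x s)" if "0 \<le> t" for t
  proof -
    have pt: "(\<lambda>n. S n s) \<longlonglongrightarrow> x s" if "s \<in> {0..t}" for s
      by (rule tendsto_uniform_limitI[OF lim that])
    have "(\<lambda>n. integral {0..t} (\<lambda>s. B s *v S n s)) \<longlonglongrightarrow> integral {0..t} (\<lambda>s. B s *v x s)"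
    proof (rule dominated_convergence)
      show "(\<lambda>s. B s *v S n s) integrable_on {0..t}" for n by (intro int S_cont)
      show "(\<lambda>s. L * suminf (M t)) integrable_on {0..t}" by (rule integrable_const_ivl)
      show "norm (B s *v S n s) \<le> L * suminf (M t)" if "s \<in> {0..t}" for n s
      proof -
        have "norm (S n s) \<le> (\<Sum>i<n. norm (u i s))" unfolding S_def by (rule norm_sum)
        also have "\<dots> \<le> (\<Sum>i<n. M t i)" by (intro sum_mono uM that)
        also have "\<dots> \<le> suminf (M t)" by (rule sum_le_suminf[OF M_sum]) (auto simp: M_nonneg)
        finally have "norm (S n s) \<le> suminf (M t)" .
        then have "L * norm (S n s) \<le> L * suminf (M t)" using \<open>0 < L\<close> by (intro mult_left_mono) auto
        with bound[of s "S n s"] show ?thesis by linarith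
      qed
      show "(\<lambda>n. B s *v S n s) \<longlonglongrightarrow> B s *v x s" if "s \<in> {0..t}" for s
        by (rule bounded_linear.tendsto[OF matrix_vector_mul_bounded_linear pt[OF that]])
    qed
    then have "(\<lambda>n. S (Suc n) t) \<longlonglongrightarrow> v + integral {0..t} (\<lambda>s. B s *v x s)"
      unfolding S_Suc[OF that] by (intro tendsto_intros)
    moreover have "(\<lambda>n. S (Suc n) t) \<longlonglongrightarrow> x t" using LIMSEQ_Suc[OF pt[of t]] that by simp
    ultimately show ?thesis by (rule LIMSEQ_unique[rotated])
  qed
  \<comment> \<open>Extended by zero to negative times, because the differentiation theorem is about
    functions that are integrable on all intervals.\<close>
  define f where "f s = (if s \<in> {0..} then B s *v x s else 0)" for s
  have f_int: "f integrable_on {a..b}" for a b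
  proof -
    have "(\<lambda>s. B s *v x s) integrable_on ({0..} \<inter> {a..b})"
    proof -
      have "continuous_on {max 0 a..b} x" by (rule continuous_on_subset[OF x_cont[of b]]) auto
      moreover have "{0..} \<inter> {a..b} = {max 0 a..b}" by auto
      ultimately show ?thesis using int by simp
    qed
    then show ?thesis unfolding f_def by (simp only: integrable_restrict_Int)
  qed
  obtain N where N: "negligible N"
    and dN: "\<And>t. t > 0 \<Longrightarrow> t \<notin> N \<Longrightarrow> ((\<lambda>u. integral {0..u} f) has_vector_derivative f t) (at t)"
    using indefinite_integral_ae_derivative[OF f_int] by blast
  have x_f: "x t = v + integral {0..t} f" if "0 \<le> t" for t
  proof -
    have "integral {0..t} f = integral {0..t} (\<lambda>s. B s *v x s)"
      by (rule Henstock_Kurzweil_Integration.integral_cong) (simp add: f_def)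
    with x_eq[OF that] show ?thesis by simp
  qed
  have "(x has_vector_derivative B t *v x t) (at t)" if "t > 0" "t \<notin> N" for t
  proof -
    have "((\<lambda>u. v + integral {0..u} f) has_vector_derivative B t *v x t) (at t)"
      using has_vector_derivative_add[OF has_vector_derivative_const dN[OF that], of v] that(1)
      by (simp add: f_def)
    then show ?thesis
      by (rule has_vector_derivative_transform_within_open[of _ _ _ "{0<..}"])
        (use that(1) x_f in auto)
  qed
  moreover have "\<exists>K. K-lipschitz_on {0..b} x" for b
  proof -
    have "bounded (x ` {0..b})" using x_cont by (intro compact_imp_bounded compact_continuous_image) auto
    then obtain C where C: "C > 0" "\<And>t. t \<in> {0..b} \<Longrightarrow> norm (x t) \<le> C" unfolding bounded_pos by auto
    have "(L * C)-lipschitz_on {0..b} x"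
    proof (rule lipschitz_if_bounded_derivative_integral[where h = f])
      fix s t :: real assume st: "0 \<le> s" "s \<le> t" "t \<le> b"
      have "integral {0..s} f + integral {s..t} f = integral {0..t} f"
        using st f_int by (intro Henstock_Kurzweil_Integration.integral_combine) auto
      then have "x t - x s = integral {s..t} f" using st x_f by (simp add: algebra_simps)
      then show "(f has_integral (x t - x s)) {s..t}" using f_int by (simp add: has_integral_iff)
    next
      show "norm (f t) \<le> L * C" if "t \<in> {0..b}" for t
      proof -
        have "L * norm (x t) \<le> L * C" using C(2)[OF that] \<open>0 < L\<close> by (intro mult_left_mono) auto
        with bound[of t "x t"] that show ?thesis by (simp add: f_def)
      qed
    qed (use \<open>0 < L\<close> C(1) in auto)
    then show ?thesis by blast
  qed
  moreover have "x 0 = v" using x_eq[of 0] by simp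
  ultimately show ?thesis using N that by blast
qed

section \<open>The dual of a switched system\<close>

lemma weighted_matrix_apply: "weighted_matrix A w *v v = (\<Sum>i\<in>UNIV. w $ i *\<^sub>R (A i *v v))"
  by (simp add: weighted_matrix_def matrix_vector_mult_sum_left scaleR_matrix_vector_assoc)

lemma weighted_matrix_transpose:
  "weighted_matrix (\<lambda>i. transpose (A i)) w = transpose (weighted_matrix A w)"
  by (simp add: weighted_matrix_def transpose_def vec_eq_iff)

lemma axis_in_weight_simplex: "axis i 1 \<in> weight_simplex"
  by (auto simp: weight_simplex_def axis_def)

lemma weighted_matrix_axis: "weighted_matrix A (axis i 1) = A i"
proof -
  have "weighted_matrix A (axis i 1) = (\<Sum>j\<in>UNIV. if j = i then A j else 0)"
    unfolding weighted_matrix_def by (intro sum.cong) (auto simp: axis_def)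
  then show ?thesis by simp
qed

lemma weighted_matrix_bound:
  fixes A :: "'m::finite \<Rightarrow> real^'n^'n"
  obtains L where "L > 0" "\<And>w v. w \<in> weight_simplex \<Longrightarrow> norm (weighted_matrix A w *v v) \<le> L * norm v"
proof -
  define L where "L = 1 + (\<Sum>i\<in>UNIV. onorm ((*v) (A i)))"
  have nn: "0 \<le> onorm ((*v) (A i))" for i by (rule onorm_pos_le) simp
  have "norm (weighted_matrix A w *v v) \<le> L * norm v" if "w \<in> weight_simplex" for w v
  proof -
    have w: "0 \<le> w $ i" "w $ i \<le> 1" for i
    proof -
      show "0 \<le> w $ i" using that by (simp add: weight_simplex_def)
      have "w $ i \<le> (\<Sum>j\<in>UNIV. w $ j)"
        using that by (intro member_le_sum) (auto simp: weight_simplex_def)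
      then show "w $ i \<le> 1" using that by (simp add: weight_simplex_def)
    qed
    have "norm (weighted_matrix A w *v v) \<le> (\<Sum>i\<in>UNIV. norm (w $ i *\<^sub>R (A i *v v)))"
      unfolding weighted_matrix_apply by (rule norm_sum)
    also have "\<dots> \<le> (\<Sum>i\<in>UNIV. onorm ((*v) (A i)) * norm v)"
    proof (rule sum_mono)
      fix i
      have "norm (w $ i *\<^sub>R (A i *v v)) \<le> 1 * norm (A i *v v)"
        using w by (simp add: mult_left_le_one_le)
      also have "\<dots> \<le> onorm ((*v) (A i)) * norm v" using onorm[of "(*v) (A i)" v] by simp
      finally show "norm (w $ i *\<^sub>R (A i *v v)) \<le> onorm ((*v) (A i)) * norm v" .
    qed
    also have "\<dots> \<le> L * norm v" by (simp add: L_def sum_distrib_right distrib_right)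
    finally show ?thesis .
  qed
  moreover have "L > 0" using sum_nonneg[of UNIV "\<lambda>i. onorm ((*v) (A i))"] nn by (simp add: L_def)
  ultimately show ?thesis using that by blast
qed

lemma equilibria_dt_iff: "x \<in> equilibria_dt A \<longleftrightarrow> (\<forall>i. A i *v x = x)"
  by (simp add: equilibria_dt_def matrix_vector_mult_diff_rdistrib)

lemma equilibria_ct_iff: "x \<in> equilibria_ct A \<longleftrightarrow> (\<forall>i. A i *v x = 0)"
  by (simp add: equilibria_ct_def)

text \<open>The inverse \<open>R\<close> of \<open>P\<close> is a Lyapunov function of the dual: with \<open>z = R (T\<^sup>T y)\<close>,
  expanding the nonnegative energy of \<open>R y - T z\<close> and using contractivity of \<open>T\<close> at \<open>z\<close> leaves
  exactly the required inequality.\<close>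

lemma weak_quadratic_lyapunov_dt_transpose:
  assumes "weak_quadratic_lyapunov_dt A P"
  shows "\<exists>R. weak_quadratic_lyapunov_dt (\<lambda>i. transpose (A i)) R"
proof -
  have pd: "positive_definite P" using assms by (simp add: weak_quadratic_lyapunov_dt_def)
  obtain R where R: "positive_definite R" "\<And>x. R *v (P *v x) = x" "\<And>x. P *v (R *v x) = x"
    using positive_definite_inverse[OF pd] by metis
  have "(transpose T *v y) \<bullet> (R *v (transpose T *v y)) \<le> y \<bullet> (R *v y)"
    if T: "\<And>x. (T *v x) \<bullet> (P *v (T *v x)) \<le> x \<bullet> (P *v x)" for T y
  proof -
    define z where "z = R *v (transpose T *v y)"
    define q where "q = (transpose T *v y) \<bullet> (R *v (transpose T *v y))"
    have yz: "y \<bullet> (T *v z) = q"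
      using inner_matrix_vector_transpose[of T z y] by (simp add: q_def z_def inner_commute)
    have Pz: "z \<bullet> (P *v z) = q" by (simp add: z_def q_def R inner_commute)
    have "0 \<le> (R *v y - T *v z) \<bullet> (P *v (R *v y - T *v z))" by (rule positive_definite_nonneg[OF pd])
    also have "\<dots> = y \<bullet> (R *v y) - 2 * q + (T *v z) \<bullet> (P *v (T *v z))"
      using positive_definite_sym[OF pd, of "R *v y" "T *v z"] yz
      by (simp add: matrix_vector_mult_diff_distrib inner_diff_left inner_diff_right R inner_commute)
    also have "\<dots> \<le> y \<bullet> (R *v y) - q" using T[of z] Pz by simp
    finally show ?thesis by (simp add: q_def)
  qed
  then have "weak_quadratic_lyapunov_dt (\<lambda>i. transpose (A i)) R"
    using assms R(1) by (simp add: weak_quadratic_lyapunov_dt_def weighted_matrix_transpose)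
  then show ?thesis by blast
qed

lemma lyapunov_form:
  fixes T P :: "real^'n^'n"
  shows "x \<bullet> ((transpose T ** P + P ** T) *v x) = (T *v x) \<bullet> (P *v x) + x \<bullet> (P *v (T *v x))"
  using inner_matrix_vector_transpose[of T x "P *v x"]
  by (simp add: matrix_vector_mult_add_rdistrib inner_add_right matrix_vector_mul_assoc[symmetric])

text \<open>The Lyapunov form of the dual at \<open>y\<close> is the original Lyapunov form at \<open>R y\<close>.\<close>

lemma weak_quadratic_lyapunov_ct_transpose:
  assumes "weak_quadratic_lyapunov_ct A P" "positive_definite R" "\<And>x. P *v (R *v x) = x"
  shows "weak_quadratic_lyapunov_ct (\<lambda>i. transpose (A i)) R"
proof -
  have pd: "positive_definite P" using assms by (simp add: weak_quadratic_lyapunov_ct_def)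
  have "y \<bullet> ((transpose (transpose T) ** R + R ** transpose T) *v y) \<le> 0"
    if T: "\<And>x. x \<bullet> ((transpose T ** P + P ** T) *v x) \<le> 0" for T y
  proof -
    have "y \<bullet> ((transpose (transpose T) ** R + R ** transpose T) *v y) = 2 * (y \<bullet> (T *v (R *v y)))"
      using positive_definite_sym[OF assms(2), of y "transpose T *v y"] inner_matrix_vector_transpose[of T "R *v y" y]
      unfolding lyapunov_form by (simp add: inner_commute)
    also have "\<dots> = (R *v y) \<bullet> ((transpose T ** P + P ** T) *v (R *v y))"
      using positive_definite_sym[OF pd, of "R *v y" "T *v (R *v y)"] assms(3)
      by (simp add: lyapunov_form inner_commute)
    finally show ?thesis using T by simp
  qed
  then show ?thesis
    using assms by (simp add: weak_quadratic_lyapunov_ct_def weighted_matrix_transpose)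
qed

lemma strongly_convergent_dt_transpose:
  assumes lyap: "weak_quadratic_lyapunov_dt A P" and sc: "strongly_convergent_dt A"
  shows "strongly_convergent_dt (\<lambda>i. transpose (A i))"
proof -
  define TT where "TT = weighted_matrix A ` weight_simplex"
  have fixed: "T *v e = e" if "T \<in> TT" "e \<in> equilibria_dt A" for T e
  proof -
    obtain w where w: "T = weighted_matrix A w" "(\<Sum>i\<in>UNIV. w $ i) = 1"
      using \<open>T \<in> TT\<close> by (auto simp: TT_def weight_simplex_def)
    show ?thesis
      using that(2) by (simp add: w weighted_matrix_apply equilibria_dt_iff scaleR_left.sum[symmetric])
  qed
  interpret convergent_contractions P TT "equilibria_dt A"
  proof
    show "positive_definite P" using lyap by (simp add: weak_quadratic_lyapunov_dt_def)
    show "(T *v x) \<bullet> (P *v (T *v x)) \<le> x \<bullet> (P *v x)" if "T \<in> TT" for T x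
      using lyap that by (auto simp: weak_quadratic_lyapunov_dt_def TT_def)
    show "subspace (equilibria_dt A)"
      by (auto simp: subspace_def equilibria_dt_iff matrix_vector_right_distrib matrix_vector_mult_scaleR)
    show "T *v e = e" if "T \<in> TT" "e \<in> equilibria_dt A" for T e using fixed[OF that] .
    show "\<exists>xbar\<in>equilibria_dt A. trajectory T x \<longlonglongrightarrow> xbar" if T: "range T \<subseteq> TT" for T x
    proof -
      have "\<forall>k. \<exists>w\<in>weight_simplex. T k = weighted_matrix A w" using T by (auto simp: TT_def)
      then obtain w where w: "\<And>k. w k \<in> weight_simplex" "\<And>k. T k = weighted_matrix A (w k)" by metis
      have "solution_dt A w (trajectory T x)" by (simp add: solution_dt_def w)
      with sc w(1) show ?thesis unfolding strongly_convergent_dt_def by blast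
    qed
  qed
  show ?thesis
    unfolding strongly_convergent_dt_def
  proof (intro allI impI, elim conjE)
    fix w :: "nat \<Rightarrow> real^'a" and y
    assume w: "\<forall>k. w k \<in> weight_simplex" and y: "solution_dt (\<lambda>i. transpose (A i)) w y"
    have "\<exists>e\<in>equilibria_dt A. y \<longlonglongrightarrow> P *v e"
    proof (rule transpose_convergent)
      show "weighted_matrix A (w k) \<in> TT" for k using w by (simp add: TT_def)
      show "y (Suc k) = transpose (weighted_matrix A (w k)) *v y k" for k
        using y by (simp add: solution_dt_def weighted_matrix_transpose)
    qed
    then obtain e where e: "e \<in> equilibria_dt A" "y \<longlonglongrightarrow> P *v e" by blast
    have "A i \<in> TT" for i
      unfolding TT_def by (metis axis_in_weight_simplex weighted_matrix_axis imageI)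
    then have "P *v e \<in> equilibria_dt (\<lambda>i. transpose (A i))"
      using transpose_fixed[OF _ e(1)] by (simp add: equilibria_dt_iff)
    with e(2) show "\<exists>xbar\<in>equilibria_dt (\<lambda>i. transpose (A i)). y \<longlonglongrightarrow> xbar" by blast
  qed
qed

lemma borel_measurable_weighted_matrix:
  assumes "w \<in> borel_measurable M"
  shows "(\<lambda>t. weighted_matrix A (w t)) \<in> borel_measurable M"
  unfolding weighted_matrix_def
  by (intro borel_measurable_sum borel_measurable_scaleR borel_measurable_const
      measurable_compose[OF assms borel_measurable_nth])

text \<open>The derivative is bounded because \<open>x\<close> is, so the fundamental theorem makes \<open>x\<close> Lipschitz
  continuous.\<close>

lemma solution_ct_solves:
  assumes sol: "solution_ct A w x" and w: "\<And>t. 0 \<le> t \<Longrightarrow> w t \<in> weight_simplex"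
  shows "solves (\<lambda>t. weighted_matrix A (w t)) 0 b x"
proof (cases "0 \<le> b")
  case False
  then show ?thesis by (auto simp: solves_def intro!: exI[of _ 0] exI[of _ "{}"] lipschitz_onI)
next
  case True
  define h where "h t = weighted_matrix A (w t) *v x t" for t
  have "AE t in lebesgue. t \<in> {0..} \<longrightarrow> (x has_vector_derivative h t) (at t within {0..})"
    using sol by (simp add: solution_ct_def h_def AE_restrict_space_iff)
  then obtain N where N: "N \<in> null_sets lebesgue"
    "\<And>t. t \<notin> N \<Longrightarrow> 0 \<le> t \<Longrightarrow> (x has_vector_derivative h t) (at t within {0..})"
    unfolding eventually_ae_filter by auto
  have neg: "negligible N" using N(1) by (simp add: negligible_iff_null_sets)
  have ac: "absolutely_continuous_on {0..b} x" using sol True by (simp add: solution_ct_def)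
  have "bounded (x ` {0..b})"
    using absolutely_continuous_imp_continuous[OF ac] by (intro compact_imp_bounded compact_continuous_image) auto
  then obtain C where C: "C > 0" "\<And>t. t \<in> {0..b} \<Longrightarrow> norm (x t) \<le> C" unfolding bounded_pos by auto
  obtain L where L: "L > 0" "\<And>w v. w \<in> weight_simplex \<Longrightarrow> norm (weighted_matrix A w *v v) \<le> L * norm v"
    using weighted_matrix_bound[of A] by blast
  have "(L * C)-lipschitz_on {0..b} x"
  proof (rule lipschitz_if_bounded_derivative_integral[where h = h])
    fix s t :: real assume st: "0 \<le> s" "s \<le> t" "t \<le> b"
    show "(h has_integral (x t - x s)) {s..t}"
    proof (rule absolutely_continuous_fundamental_theorem[OF st(2) _ neg])
      show "absolutely_continuous_on {s..t} x"
        by (rule absolutely_continuous_on_subset[OF ac]) (use st in auto)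
      show "(x has_vector_derivative h r) (at r within {s..t})" if "r \<in> {s..t} - N" for r
        by (rule has_vector_derivative_within_subset[OF N(2)]) (use that st in auto)
    qed
  next
    fix t assume t: "t \<in> {0..b}"
    have "norm (h t) \<le> L * norm (x t)" using L(2) w t by (simp add: h_def)
    also have "\<dots> \<le> L * C" using C(2)[OF t] L(1) by (intro mult_left_mono) auto
    finally show "norm (h t) \<le> L * C" .
  qed (use L C in auto)
  moreover have "(x has_vector_derivative h t) (at t)" if "t \<in> {0<..<b} - N" for t
  proof -
    have "at t within {0..} = at t" using that by (intro at_within_interior) auto
    with N(2)[of t] that show ?thesis by simp
  qed
  ultimately show ?thesis using neg unfolding solves_def h_def by blast
qed

lemma solution_ct_exists:
  assumes meas: "w \<in> borel_measurable lebesgue" and w: "\<And>t. w t \<in> weight_simplex"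
  obtains x where "x 0 = v" "solution_ct A w x"
proof -
  define B where "B t = weighted_matrix A (w t)" for t
  obtain L where L: "L > 0" "\<And>w v. w \<in> weight_simplex \<Longrightarrow> norm (weighted_matrix A w *v v) \<le> L * norm v"
    using weighted_matrix_bound[of A] by blast
  have "B \<in> borel_measurable lebesgue"
    unfolding B_def by (rule borel_measurable_weighted_matrix[OF meas])
  moreover have "norm (B t *v z) \<le> L * norm z" for t z using L(2)[OF w] by (simp add: B_def)
  ultimately obtain x N where x: "x 0 = v" and N: "negligible N"
    and d: "\<And>t. t > 0 \<Longrightarrow> t \<notin> N \<Longrightarrow> (x has_vector_derivative B t *v x t) (at t)"
    and lip: "\<And>b. \<exists>K. K-lipschitz_on {0..b} x"
    using caratheodory_existence[of B L v] L(1) by blast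
  \<comment> \<open>The derivative at time zero is one-sided and is not provided by the existence theorem.\<close>
  have "negligible (insert 0 N)" using N by simp
  then have "insert 0 N \<in> null_sets lebesgue" by (simp add: negligible_iff_null_sets)
  then have "AE t in lebesgue. t \<in> {0..} \<longrightarrow> (x has_vector_derivative B t *v x t) (at t within {0..})"
    by (rule AE_I') (use d in \<open>force intro: has_vector_derivative_at_within\<close>)
  then have "solution_ct A w x"
    using lip lipschitz_imp_absolutely_continuous
    unfolding solution_ct_def B_def by (simp add: AE_restrict_space_iff) blast
  with x show ?thesis by (rule that)
qed

lemma borel_measurable_affine:
  fixes w :: "real \<Rightarrow> 'b::topological_space"
  assumes "w \<in> borel_measurable lebesgue" "c \<noteq> 0"
  shows "(\<lambda>t. w (a + c * t)) \<in> borel_measurable lebesgue"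
  using measurable_compose[OF lebesgue_affine_measurable[of "\<lambda>_. c" a] assms(1)] assms(2) by simp

lemma borel_measurable_concatenation:
  fixes w :: "nat \<Rightarrow> real \<Rightarrow> 'b::topological_space"
  assumes "\<And>k. w k \<in> borel_measurable lebesgue"
  shows "(\<lambda>t. w (nat \<lfloor>t\<rfloor>) (t - real (nat \<lfloor>t\<rfloor>))) \<in> borel_measurable lebesgue"
proof (rule measurable_compose_countable[where f = "\<lambda>k t. w k (t - real k)"])
  show "(\<lambda>t. w k (t - real k)) \<in> borel_measurable lebesgue" for k
    using borel_measurable_affine[OF assms, of 1 k "- real k"] by (simp add: algebra_simps)
  have "(\<lambda>t::real. nat \<lfloor>t\<rfloor>) \<in> lborel \<rightarrow>\<^sub>M count_space UNIV"
    using measurable_compose[OF measurable_real_floor, of nat "count_space UNIV"] by simp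
  then show "(\<lambda>t::real. nat \<lfloor>t\<rfloor>) \<in> lebesgue \<rightarrow>\<^sub>M count_space UNIV"
    by (rule measurable_completion)
qed

text \<open>The time-one maps. Controls live on the whole line, where shifting and reversing time need no
  case distinctions; only their values on \<open>{0<..<1}\<close> matter.\<close>

definition transition_matrices :: "('m::finite \<Rightarrow> real^'n^'n) \<Rightarrow> (real^'n^'n) set" where
  "transition_matrices A = {T. \<exists>w \<in> borel_measurable lebesgue. (\<forall>t. w t \<in> weight_simplex) \<and>
    (\<forall>x. solves (\<lambda>t. weighted_matrix A (w t)) 0 1 x \<longrightarrow> x 1 = T *v x 0)}"

text \<open>The rows of the time-one matrix are the final values of the dual solutions, under the
  reversed control, that start at the basis vectors. The adjoint identity then gives uniqueness and
  linear dependence on the initial value at once, for the system as well as for its dual.\<close>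

lemma transition_matrix_exists:
  assumes meas: "w \<in> borel_measurable lebesgue" and w: "\<And>t. w t \<in> weight_simplex"
  obtains T where "T \<in> transition_matrices A"
    "\<And>y. solves (\<lambda>t. transpose (weighted_matrix A (w (1 - t)))) 0 1 y \<Longrightarrow> y 1 = transpose T *v y 0"
proof -
  define B where "B t = weighted_matrix A (w t)" for t
  have meas': "(\<lambda>t. w (1 - t)) \<in> borel_measurable lebesgue"
    using borel_measurable_affine[OF meas, of "-1" 1] by simp
  have "\<exists>y. y 0 = axis j 1 \<and> solves (\<lambda>t. transpose (B (1 - t))) 0 1 y" for j
  proof -
    obtain y where "y 0 = axis j 1" "solution_ct (\<lambda>i. transpose (A i)) (\<lambda>t. w (1 - t)) y"
      by (rule solution_ct_exists[OF meas' w])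
    with solution_ct_solves[OF this(2) w, of 1] show ?thesis
      by (auto simp: weighted_matrix_transpose B_def)
  qed
  then obtain Y where Y: "\<And>j. Y j 0 = axis j 1" "\<And>j. solves (\<lambda>t. transpose (B (1 - t))) 0 1 (Y j)" by metis
  define T where "T = (\<chi> j. Y j 1)"
  have T: "x 1 = T *v x 0" if "solves B 0 1 x" for x
  proof -
    have "x 1 $ j = (T *v x 0) $ j" for j
      using solves_adjoint[OF that Y(2)[of j]] Y(1)[of j]
      by (simp add: T_def matrix_vector_mul_component inner_axis inner_commute)
    then show ?thesis by (simp add: vec_eq_iff)
  qed
  have "y 1 = transpose T *v y 0" if y: "solves (\<lambda>t. transpose (B (1 - t))) 0 1 y" for y
  proof -
    have "v \<bullet> y 1 = v \<bullet> (transpose T *v y 0)" for v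
    proof -
      obtain x where x: "x 0 = v" "solution_ct A w x" by (rule solution_ct_exists[OF meas w])
      have "solves B 0 1 x" unfolding B_def by (rule solution_ct_solves[OF x(2) w])
      from solves_adjoint[OF this y] T[OF this] x(1) show ?thesis
        by (simp add: inner_matrix_vector_transpose)
    qed
    then show ?thesis using vector_eq_ldot by blast
  qed
  moreover have "T \<in> transition_matrices A"
    unfolding transition_matrices_def using meas w T by (auto simp: B_def[abs_def])
  ultimately show ?thesis using that by (simp add: B_def)
qed

text \<open>A trajectory of the family of time-one maps is the restriction to integer times of a
  solution, for the control that uses the \<open>k\<close>-th chosen control during the \<open>k\<close>-th time unit.\<close>

lemma convergent_contractions_transition_matrices:
  assumes lyap: "weak_quadratic_lyapunov_ct A P" and sc: "strongly_convergent_ct A"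
  shows "convergent_contractions P (transition_matrices A) (equilibria_ct A)"
proof
  show pd: "positive_definite P" using lyap by (simp add: weak_quadratic_lyapunov_ct_def)
  show "subspace (equilibria_ct A)"
    by (auto simp: subspace_def equilibria_ct_iff matrix_vector_right_distrib matrix_vector_mult_scaleR)
  fix T assume T: "T \<in> transition_matrices A"
  then obtain w where w: "w \<in> borel_measurable lebesgue" "\<And>t. w t \<in> weight_simplex"
    and Tw: "\<And>x. solves (\<lambda>t. weighted_matrix A (w t)) 0 1 x \<Longrightarrow> x 1 = T *v x 0"
    unfolding transition_matrices_def by blast
  show "(T *v v) \<bullet> (P *v (T *v v)) \<le> v \<bullet> (P *v v)" for v
  proof -
    obtain x where x: "x 0 = v" "solution_ct A w x" by (rule solution_ct_exists[OF w])
    have s: "solves (\<lambda>t. weighted_matrix A (w t)) 0 1 x" by (rule solution_ct_solves[OF x(2) w(2)])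
    have "x 1 \<bullet> (P *v x 1) \<le> x 0 \<bullet> (P *v x 0)"
      by (rule solves_energy_decreasing[OF s])
        (use lyap w(2) in \<open>auto simp: weak_quadratic_lyapunov_ct_def positive_definite_def\<close>)
    then show ?thesis using Tw[OF s] x(1) by simp
  qed
  show "T *v e = e" if "e \<in> equilibria_ct A" for e
    using Tw[OF solves_const[of _ e]] that by (simp add: weighted_matrix_apply equilibria_ct_iff)
next
  fix T :: "nat \<Rightarrow> real^'b^'b" and v assume "range T \<subseteq> transition_matrices A"
  then have "\<forall>k. \<exists>w. w \<in> borel_measurable lebesgue \<and> (\<forall>t. w t \<in> weight_simplex) \<and>
    (\<forall>x. solves (\<lambda>t. weighted_matrix A (w t)) 0 1 x \<longrightarrow> x 1 = T k *v x 0)"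
    unfolding transition_matrices_def by blast
  then obtain w where w: "\<And>k. w k \<in> borel_measurable lebesgue" "\<And>k t. w k t \<in> weight_simplex"
    and Tw: "\<And>k x. solves (\<lambda>t. weighted_matrix A (w k t)) 0 1 x \<Longrightarrow> x 1 = T k *v x 0"
    by metis
  define W where "W t = w (nat \<lfloor>t\<rfloor>) (t - real (nat \<lfloor>t\<rfloor>))" for t
  have W: "W \<in> borel_measurable lebesgue" "\<And>t. W t \<in> weight_simplex"
    unfolding W_def using borel_measurable_concatenation[OF w(1)] w(2) by auto
  obtain x where x: "x 0 = v" "solution_ct A W x" by (rule solution_ct_exists[OF W])
  have step: "x (real (Suc k)) = T k *v x (real k)" for k
  proof -
    have "solves (\<lambda>t. weighted_matrix A (W t)) (0 + real k) (1 + real k) x"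
      using solves_subset[OF solution_ct_solves[OF x(2) W(2), of "1 + real k"]] by simp
    from solves_shift[OF this]
    have "solves (\<lambda>t. weighted_matrix A (w k t)) 0 1 (\<lambda>t. x (t + real k))"
    proof (rule solves_cong)
      fix t :: real assume "0 < t" "t < 1"
      then have "\<lfloor>t + real k\<rfloor> = int k" by linarith
      then show "weighted_matrix A (W (t + real k)) = weighted_matrix A (w k t)" by (simp add: W_def)
    qed
    from Tw[OF this] show ?thesis by (simp add: add.commute)
  qed
  obtain xbar where xbar: "xbar \<in> equilibria_ct A" "(x \<longlongrightarrow> xbar) at_top"
    using sc W x(2) measurable_restrict_space1[OF W(1), of "{0..}"]
    unfolding strongly_convergent_ct_def by blast
  have "(\<lambda>k. x (real k)) \<longlonglongrightarrow> xbar"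
    by (rule filterlim_compose[OF xbar(2) filterlim_real_sequentially])
  moreover have "trajectory T v k = x (real k)" for k
    using trajectory_unique[of "\<lambda>k. x (real k)" T k] step x(1) by simp
  ultimately have "trajectory T v \<longlonglongrightarrow> xbar" by presburger
  with xbar(1) show "\<exists>xbar\<in>equilibria_ct A. trajectory T v \<longlonglongrightarrow> xbar" by blast
qed

lemma equilibria_ct_transpose:
  assumes lyap: "weak_quadratic_lyapunov_ct A P" and e: "e \<in> equilibria_ct A"
  shows "P *v e \<in> equilibria_ct (\<lambda>i. transpose (A i))"
proof -
  have "transpose (A i) *v (P *v e) = 0" for i
  proof -
    define B where "B = - (transpose (A i) ** P + P ** A i)"
    have Bx: "B *v x = - ((transpose (A i) ** P + P ** A i) *v x)" for x
      unfolding B_def by (metis matrix_vector_mult_diff_rdistrib diff_0 matrix_vector_mult_0)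
    have Ae: "A i *v e = 0" using e by (simp add: equilibria_ct_iff)
    have "B *v e = 0"
    proof (rule kernel_of_nonneg_form)
      show "transpose B = B"
        using lyap matrix_transpose_mul[of "transpose (A i)" P] matrix_transpose_mul[of P "A i"]
        by (simp add: B_def weak_quadratic_lyapunov_ct_def positive_definite_def)
          (simp add: transpose_def vec_eq_iff)
      show "0 \<le> x \<bullet> (B *v x)" for x
        using lyap axis_in_weight_simplex[of i] weighted_matrix_axis[of A i]
        by (simp add: Bx weak_quadratic_lyapunov_ct_def) metis
      show "e \<bullet> (B *v e) = 0" using Ae by (simp add: Bx lyapunov_form)
    qed
    then show ?thesis
      using Ae by (simp add: Bx matrix_vector_mult_add_rdistrib matrix_vector_mul_assoc[symmetric])
  qed
  then show ?thesis by (simp add: equilibria_ct_iff)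
qed

text \<open>At integer times the dual solution is a trajectory of transposed time-one maps, so it
  converges to some \<open>P e\<close>. The distance to this equilibrium is nonincreasing in the energy norm
  of \<open>R\<close>, hence convergence along the integers is convergence.\<close>

lemma strongly_convergent_ct_transpose:
  assumes lyap: "weak_quadratic_lyapunov_ct A P" and sc: "strongly_convergent_ct A"
  shows "strongly_convergent_ct (\<lambda>i. transpose (A i))"
  unfolding strongly_convergent_ct_def
proof (intro allI impI, elim conjE)
  fix w :: "real \<Rightarrow> real^'a" and y
  assume meas: "w \<in> borel_measurable (lebesgue_on {0..})" and w: "\<forall>t\<ge>0. w t \<in> weight_simplex"
    and y: "solution_ct (\<lambda>i. transpose (A i)) w y"
  interpret convergent_contractions P "transition_matrices A" "equilibria_ct A"
    by (rule convergent_contractions_transition_matrices[OF lyap sc])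
  obtain R where R: "positive_definite R" "\<And>x. R *v (P *v x) = x" "\<And>x. P *v (R *v x) = x"
    using positive_definite_inverse[OF pd] by metis
  define B where "B t = transpose (weighted_matrix A (w t))" for t
  have sol: "solves B 0 b y" for b
    using solution_ct_solves[OF y] w by (simp add: B_def[abs_def] weighted_matrix_transpose)
  define W where "W t = (if t \<in> {0..} then w t else w 0)" for t
  have W: "\<And>t. W t \<in> weight_simplex" using w by (simp add: W_def)
  have "W = (\<lambda>t. (if t \<in> {0..} then w t else 0) + indicat_real {..<0} t *\<^sub>R w 0)"
    by (auto simp: W_def indicator_def)
  moreover have "(\<lambda>t. (if t \<in> {0..} then w t else 0) + indicat_real {..<0} t *\<^sub>R w 0) \<in> borel_measurable lebesgue"
    by (intro borel_measurable_add borel_measurable_if_I[OF meas] borel_measurable_scaleR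
        borel_measurable_indicator borel_measurable_const) auto
  ultimately have Wm: "W \<in> borel_measurable lebesgue" by simp
  have "\<exists>T\<in>transition_matrices A. y (real (Suc k)) = transpose T *v y (real k)" for k
  proof -
    \<comment> \<open>The control of the \<open>k\<close>-th time unit, reversed: the adjoint identity reverses it again.\<close>
    have "(\<lambda>s. W (real k + 1 - s)) \<in> borel_measurable lebesgue"
      using borel_measurable_affine[OF Wm, of "-1" "real k + 1"] by simp
    then obtain T where T: "T \<in> transition_matrices A"
      "\<And>z. solves (\<lambda>t. transpose (weighted_matrix A (W (real k + 1 - (1 - t))))) 0 1 z \<Longrightarrow> z 1 = transpose T *v z 0"
      using transition_matrix_exists[of "\<lambda>s. W (real k + 1 - s)" A] W by blast
    have "solves B (0 + real k) (1 + real k) y"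
      using solves_subset[OF sol[of "1 + real k"]] by simp
    from solves_shift[OF this]
    have "solves (\<lambda>t. transpose (weighted_matrix A (W (real k + 1 - (1 - t))))) 0 1 (\<lambda>t. y (t + real k))"
      by (rule solves_cong) (simp add: B_def W_def add.commute)
    from T(2)[OF this] T(1) show ?thesis by (auto simp: add.commute)
  qed
  then obtain T where T: "\<And>k. T k \<in> transition_matrices A" "\<And>k. y (real (Suc k)) = transpose (T k) *v y (real k)"
    by metis
  obtain e where e: "e \<in> equilibria_ct A" "(\<lambda>k. y (real k)) \<longlonglongrightarrow> P *v e"
    using transpose_convergent[of T "\<lambda>k. y (real k)"] T by blast
  have eq: "P *v e \<in> equilibria_ct (\<lambda>i. transpose (A i))" by (rule equilibria_ct_transpose[OF lyap e(1)])
  define d where "d t = y t - P *v e" for t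
  have B0: "B t *v (P *v e) = 0" for t
    using eq weighted_matrix_transpose[of A "w t", symmetric] by (simp add: B_def weighted_matrix_apply equilibria_ct_iff)
  have d: "solves B 0 b d" for b
    unfolding d_def by (rule solves_diff[OF sol solves_const[OF B0]])
  have lyap': "weak_quadratic_lyapunov_ct (\<lambda>i. transpose (A i)) R"
    by (rule weak_quadratic_lyapunov_ct_transpose[OF lyap R(1) R(3)])
  have mono: "energy_norm R (d t) \<le> energy_norm R (d s)" if "0 \<le> s" "s \<le> t" for s t
  proof -
    have "d t \<bullet> (R *v d t) \<le> d s \<bullet> (R *v d s)"
    proof (rule solves_energy_decreasing[OF solves_subset[OF d that(1) order_refl] that(2)])
      show "transpose R = R" using R(1) by (simp add: positive_definite_def)
      show "v \<bullet> ((transpose (B r) ** R + R ** B r) *v v) \<le> 0" if "s < r" "r < t" for r v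
        using lyap' w that \<open>0 \<le> s\<close> by (auto simp: weak_quadratic_lyapunov_ct_def B_def weighted_matrix_transpose)
    qed
    then show ?thesis by (simp add: energy_norm_def)
  qed
  have lim: "(\<lambda>k. energy_norm R (d (real k))) \<longlonglongrightarrow> 0"
    using tendsto_energy_norm[OF R(1) LIM_zero[OF e(2)]] by (simp add: d_def energy_norm_def)
  have "((\<lambda>t. energy_norm R (d t)) \<longlongrightarrow> 0) at_top"
  proof (rule tendstoI)
    fix \<epsilon> :: real assume "0 < \<epsilon>"
    then obtain k where k: "energy_norm R (d (real k)) < \<epsilon>"
      using order_tendstoD(2)[OF lim] eventually_happens by fastforce
    show "eventually (\<lambda>t. dist (energy_norm R (d t)) 0 < \<epsilon>) at_top"
      using eventually_ge_at_top[of "real k"]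
    proof eventually_elim
      case (elim t)
      with mono[of "real k" t] k energy_norm_nonneg[OF R(1), of "d t"] show ?case by simp
    qed
  qed
  then have "(d \<longlongrightarrow> 0) at_top" by (rule tendsto_0_if_energy_norm[OF R(1)])
  then have "(y \<longlongrightarrow> P *v e) at_top" unfolding d_def by (rule LIM_zero_cancel)
  with eq show "\<exists>xbar\<in>equilibria_ct (\<lambda>i. transpose (A i)). (y \<longlongrightarrow> xbar) at_top" by blast
qed

theorem theorem7:
  fixes A :: "'m::finite \<Rightarrow> real^'n^'n"
  shows "((\<exists>P. weak_quadratic_lyapunov_dt A P) \<longrightarrow>
            (strongly_convergent_dt A \<longleftrightarrow> strongly_convergent_dt (\<lambda>i. transpose (A i)))) \<and>
         ((\<exists>P. weak_quadratic_lyapunov_ct A P) \<longrightarrow>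
            (strongly_convergent_ct A \<longleftrightarrow> strongly_convergent_ct (\<lambda>i. transpose (A i))))"
proof (intro conjI impI iffI; elim exE)
  fix P assume P: "weak_quadratic_lyapunov_dt A P"
  show "strongly_convergent_dt (\<lambda>i. transpose (A i))" if "strongly_convergent_dt A"
    using strongly_convergent_dt_transpose[OF P that] .
  obtain R where "weak_quadratic_lyapunov_dt (\<lambda>i. transpose (A i)) R"
    using weak_quadratic_lyapunov_dt_transpose[OF P] by blast
  from strongly_convergent_dt_transpose[OF this]
  show "strongly_convergent_dt A" if "strongly_convergent_dt (\<lambda>i. transpose (A i))"
    using that by simp
next
  fix P assume P: "weak_quadratic_lyapunov_ct A P"
  show "strongly_convergent_ct (\<lambda>i. transpose (A i))" if "strongly_convergent_ct A"
    using strongly_convergent_ct_transpose[OF P that] .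
  have "positive_definite P" using P by (simp add: weak_quadratic_lyapunov_ct_def)
  then obtain R where "positive_definite R" "\<And>x. P *v (R *v x) = x"
    using positive_definite_inverse by metis
  from strongly_convergent_ct_transpose[OF weak_quadratic_lyapunov_ct_transpose[OF P this]]
  show "strongly_convergent_ct A" if "strongly_convergent_ct (\<lambda>i. transpose (A i))"
    using that by simp
qed

end
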